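(* Let $\mathbf{A}$ be a finite algebra (in the sense of universal algebra), let $\beta$ be a congruence of $\mathbf{A}$, and let $k\geq 1$ be an integer. Consider the following properties. (1) $\beta$ is $k$-supernilpotent. (2) $\mathbf{A}$ has no $\beta^{[k+1]}$-snags. (3) For every minimal set $U$ of $\mathbf{A}$, the $\beta$-twin monoid $\mathrm{Tw}_\beta(\mathbf{A},U)$ acts on $U$ as a nilpotent group of permutations, with nilpotence class at most $k$. (4) $C(\beta,\theta;\delta)$ and $C(\theta,\beta;\delta)$ hold whenever $\delta\prec\theta$ in $\mathrm{Con}(\mathbf{A})$. (5) $\beta$ is both left nilpotent and right nilpotent, i.e. $(\beta]^{\ell}=0$ and $[\beta)^{m}=0$ for some positive integers $\ell,m$. Then $(1)\Rightarrow(2)\Rightarrow(3)\Rightarrow(4)\Rightarrow(5)$.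
   Context: Let $\mathbf{A}$ be an algebra with universe $A$. $\mathrm{Con}(\mathbf{A})$ is its congruence lattice, with least element $0$ (the equality relation); $\delta\prec\theta$ means that $\theta$ covers $\delta$ in $\mathrm{Con}(\mathbf{A})$. $\mathrm{Pol}(\mathbf{A})$ is the set of polynomial operations of $\mathbf{A}$ and $\mathrm{Pol}_1(\mathbf{A})$ the set of unary ones. Matrices. For $\alpha_1,\dots,\alpha_n\in\mathrm{Con}(\mathbf{A})$, an $\alpha_1,\dots,\alpha_n$-matrix ($n$-dimensional) is a function $m:\{0,1\}^n\to A$ of the form $m(\varepsilon_1,\dots,\varepsilon_n)=f(\mathbf{a}_1^{\varepsilon_1},\dots,\mathbf{a}_n^{\varepsilon_n})$, where $f\in\mathrm{Pol}(\mathbf{A})$ and, for each $i$, $\mathbf{a}_i^0,\mathbf{a}_i^1$ are finite tuples of elements of $A$ of the same length that are coordinatewise $\alpha_i$-related. The set of these is $M(\alpha_1,\dots,\alpha_n)$. Centrality. For $\delta\in\mathrm{Con}(\mathbf{A})$, $C(\alpha_1,\dots,\alpha_n;\delta)$ holds if for every $m\in M(\alpha_1,\dots,\alpha_n)$: whenever $m(\varepsilon,0)\mathrel{\delta}m(\varepsilon,1)$ for all $\varepsilon\in\{0,1\}^{n-1}\setminus\{(1,\dots,1)\}$, then also $m(1,\dots,1,0)\mathrel{\delta}m(1,\dots,1,1)$. For $n=2$, $C(\alpha,\beta;\delta)$ thus says: for all $f\in\mathrm{Pol}(\mathbf{A})$, $\mathbf{a}\mathrel{\alpha}\mathbf{a}'$,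 $\mathbf{b}\mathrel{\beta}\mathbf{b}'$, if $f(\mathbf{a},\mathbf{b})\mathrel{\delta}f(\mathbf{a},\mathbf{b}')$ then $f(\mathbf{a}',\mathbf{b})\mathrel{\delta}f(\mathbf{a}',\mathbf{b}')$. The commutator $[\alpha_1,\dots,\alpha_n]$ is the least $\delta$ such that $C(\alpha_1,\dots,\alpha_n;\delta)$ holds. Supernilpotence. $\beta$ is $k$-supernilpotent if $C(\beta,\dots,\beta;0)$ holds with $k+1$ instances of $\beta$ before the semicolon (equivalently, $[\beta,\dots,\beta]=0$ with $k+1$ $\beta$'s). Nilpotence. For a congruence $\theta$, put $(\theta]^1=[\theta)^1=\theta$, $(\theta]^{\ell+1}=[\theta,(\theta]^{\ell}]$ and $[\theta)^{m+1}=[[\theta)^{m},\theta]$ (binary commutators). $\theta$ is left nilpotent if $(\theta]^{\ell}=0$ for some $\ell$, and right nilpotent if $[\theta)^m=0$ for some $m$. Snags. A $\beta^{[n]}$-snag is a pair $(u,v)\in A^2$ with $u\neq v$ for which there is an $n$-dimensional matrix in $M(\beta,\dots,\beta)$ ($n$ $\beta$'s) such that $2^n-1$ of its $2^n$ entries equal $u$ and the remaining entry (in any position) equals $v$. Twin monoids. Two polynomials $f,g\in\mathrm{Pol}_1(\mathbf{A})$ are $\beta$-twins if there are a polynomial $h(x,\mathbf{y})$ of $\mathbf{A}$ and coordinatewise $\beta$-related tuples $\mathbf{a},\mathbf{b}$ with $f(x)=h(x,\mathbf{a})$ and $g(x)=h(x,\mathbf{b})$ on $A$. For $U\subseteq A$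 of the form $U=e(A)$ with $e\in\mathrm{Pol}_1(\mathbf{A})$, $e\circ e=e$, the monoid $\mathrm{Tw}_\beta(\mathbf{A},U)$ consists of all maps $f|_U:U\to U$ where $f\in\mathrm{Pol}_1(\mathbf{A})$ satisfies $f(A)\subseteq U$ and $f$ is a $\beta$-twin of some $g\in\mathrm{Pol}_1(\mathbf{A})$ whose restriction to $U$ is the identity function on $U$. To say it acts as a nilpotent group of permutations of class at most $k$ means that all its members are permutations of $U$ and that, under composition, they form a nilpotent group of class at most $k$. Minimal sets (tame congruence theory). For $\delta\prec\theta$ in $\mathrm{Con}(\mathbf{A})$, $\mathrm{Min}_{\mathbf{A}}(\delta,\theta)$ is the set of inclusion-minimal members of $\{f(A): f\in\mathrm{Pol}_1(\mathbf{A}),\ f(\theta)\not\subseteq\delta\}$, where $f(\theta)=\{(f(x),f(y)):(x,y)\in\theta\}$. A minimal set of $\mathbf{A}$ is a member of $\mathrm{Min}_{\mathbf{A}}(\delta,\theta)$ for some $\delta\prec\theta$. For finite $\mathbf{A}$ every minimal set is the image of an idempotent unary polynomial. *)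

theory Defs
  imports "HOL-Algebra.Bij" "HOL-Algebra.Generated_Groups"
begin

(* An algebra with universe UNIV :: 'a set.  The set of operation symbols may be empty,
   and nullary operations are allowed.  interp A s is only meaningful on lists of
   length arity A s. *)
record ('s, 'a) ualgebra =
  symbols :: "'s set"
  arity :: "'s \<Rightarrow> nat"
  interp :: "'s \<Rightarrow> 'a list \<Rightarrow> 'a"

definition Con :: "('s, 'a) ualgebra \<Rightarrow> 'a rel set" where
  "Con A = {\<theta>. equiv UNIV \<theta> \<and>
     (\<forall>s\<in>symbols A. \<forall>xs ys. length xs = arity A s \<longrightarrow>
        list_all2 (\<lambda>x y. (x, y) \<in> \<theta>) xs ys \<longrightarrow> (interp A s xs, interp A s ys) \<in> \<theta>)}"

definition covers :: "('s, 'a) ualgebra \<Rightarrow> 'a rel \<Rightarrow> 'a rel \<Rightarrow> bool" where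
  "covers A \<delta> \<theta> \<longleftrightarrow> \<delta> \<in> Con A \<and> \<theta> \<in> Con A \<and> \<delta> \<subset> \<theta> \<and> \<not> (\<exists>\<gamma>\<in>Con A. \<delta> \<subset> \<gamma> \<and> \<gamma> \<subset> \<theta>)"

(* n-ary polynomial operations, as functions on lists; their values on lists of length
   other than n are irrelevant. *)
inductive_set Pol :: "('s, 'a) ualgebra \<Rightarrow> nat \<Rightarrow> ('a list \<Rightarrow> 'a) set"
  for A :: "('s, 'a) ualgebra" and n :: nat where
  proj: "i < n \<Longrightarrow> (\<lambda>xs. xs ! i) \<in> Pol A n"
| const: "(\<lambda>_. c) \<in> Pol A n"
| app: "s \<in> symbols A \<Longrightarrow> length ps = arity A s \<Longrightarrow> \<forall>p\<in>set ps. p \<in> Pol A n \<Longrightarrow>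
    (\<lambda>xs. interp A s (map (\<lambda>p. p xs) ps)) \<in> Pol A n"

definition Pol1 :: "('s, 'a) ualgebra \<Rightarrow> ('a \<Rightarrow> 'a) set" where
  "Pol1 A = {\<lambda>x. p [x] | p. p \<in> Pol A 1}"

(* {0,1}^n, with 0 = False and 1 = True *)
definition cube :: "nat \<Rightarrow> bool list set" where
  "cube n = {e. length e = n}"

(* M(alpha_1, ..., alpha_n) for the list [alpha_1, ..., alpha_n]; here a i False and
   a i True are the two tuples belonging to coordinate i (counted from 0). *)
definition matrices :: "('s, 'a) ualgebra \<Rightarrow> 'a rel list \<Rightarrow> (bool list \<Rightarrow> 'a) set" where
  "matrices A \<alpha>s =
     {(\<lambda>e\<in>cube (length \<alpha>s). f (concat (map (\<lambda>i. a i (e ! i)) [0..<length \<alpha>s]))) | f a.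
        (\<forall>i<length \<alpha>s. list_all2 (\<lambda>x y. (x, y) \<in> \<alpha>s ! i) (a i False) (a i True)) \<and>
        f \<in> Pol A (\<Sum>i<length \<alpha>s. length (a i False))}"

(* C(alpha_1, ..., alpha_n; delta), intended for n >= 1 *)
definition centralizes :: "('s, 'a) ualgebra \<Rightarrow> 'a rel list \<Rightarrow> 'a rel \<Rightarrow> bool" where
  "centralizes A \<alpha>s \<delta> \<longleftrightarrow>
     (\<forall>m\<in>matrices A \<alpha>s.
        (\<forall>e\<in>cube (length \<alpha>s - 1) - {replicate (length \<alpha>s - 1) True}.
           (m (e @ [False]), m (e @ [True])) \<in> \<delta>) \<longrightarrow>
        (m (replicate (length \<alpha>s - 1) True @ [False]),
         m (replicate (length \<alpha>s - 1) True @ [True])) \<in> \<delta>)"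

definition commutator :: "('s, 'a) ualgebra \<Rightarrow> 'a rel list \<Rightarrow> 'a rel" where
  "commutator A \<alpha>s = (LEAST \<delta>. \<delta> \<in> Con A \<and> centralizes A \<alpha>s \<delta>)"

definition supernilpotent :: "('s, 'a) ualgebra \<Rightarrow> nat \<Rightarrow> 'a rel \<Rightarrow> bool" where
  "supernilpotent A k \<beta> \<longleftrightarrow> centralizes A (replicate (k + 1) \<beta>) Id"

(* (theta]^l and [theta)^l, indexed from l = 1 *)
definition left_power :: "('s, 'a) ualgebra \<Rightarrow> 'a rel \<Rightarrow> nat \<Rightarrow> 'a rel" where
  "left_power A \<theta> l = ((\<lambda>\<gamma>. commutator A [\<theta>, \<gamma>]) ^^ (l - 1)) \<theta>"

definition right_power :: "('s, 'a) ualgebra \<Rightarrow> 'a rel \<Rightarrow> nat \<Rightarrow> 'a rel" where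
  "right_power A \<theta> l = ((\<lambda>\<gamma>. commutator A [\<gamma>, \<theta>]) ^^ (l - 1)) \<theta>"

definition left_nilpotent :: "('s, 'a) ualgebra \<Rightarrow> 'a rel \<Rightarrow> bool" where
  "left_nilpotent A \<theta> \<longleftrightarrow> (\<exists>l\<ge>1. left_power A \<theta> l = Id)"

definition right_nilpotent :: "('s, 'a) ualgebra \<Rightarrow> 'a rel \<Rightarrow> bool" where
  "right_nilpotent A \<theta> \<longleftrightarrow> (\<exists>l\<ge>1. right_power A \<theta> l = Id)"

definition snags :: "('s, 'a) ualgebra \<Rightarrow> 'a rel \<Rightarrow> nat \<Rightarrow> ('a \<times> 'a) set" where
  "snags A \<beta> n = {(u, v). u \<noteq> v \<and>
     (\<exists>m\<in>matrices A (replicate n \<beta>). \<exists>e\<in>cube n. m e = v \<and> (\<forall>e'\<in>cube n - {e}. m e' = u))}"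

definition twins :: "('s, 'a) ualgebra \<Rightarrow> 'a rel \<Rightarrow> ('a \<Rightarrow> 'a) \<Rightarrow> ('a \<Rightarrow> 'a) \<Rightarrow> bool" where
  "twins A \<beta> f g \<longleftrightarrow> f \<in> Pol1 A \<and> g \<in> Pol1 A \<and>
     (\<exists>as bs. list_all2 (\<lambda>x y. (x, y) \<in> \<beta>) as bs \<and>
        (\<exists>h\<in>Pol A (Suc (length as)). (\<forall>x. f x = h (x # as)) \<and> (\<forall>x. g x = h (x # bs))))"

definition Tw :: "('s, 'a) ualgebra \<Rightarrow> 'a rel \<Rightarrow> 'a set \<Rightarrow> ('a \<Rightarrow> 'a) set" where
  "Tw A \<beta> U = {restrict f U | f. f \<in> Pol1 A \<and> range f \<subseteq> U \<and>
     (\<exists>g\<in>Pol1 A. twins A \<beta> f g \<and> (\<forall>x\<in>U. g x = x))}"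

definition Min_sets :: "('s, 'a) ualgebra \<Rightarrow> 'a rel \<Rightarrow> 'a rel \<Rightarrow> 'a set set" where
  "Min_sets A \<delta> \<theta> =
     (let S = {range f | f. f \<in> Pol1 A \<and> \<not> map_prod f f ` \<theta> \<subseteq> \<delta>}
      in {U \<in> S. \<forall>V\<in>S. V \<subseteq> U \<longrightarrow> V = U})"

definition minimal_set :: "('s, 'a) ualgebra \<Rightarrow> 'a set \<Rightarrow> bool" where
  "minimal_set A U \<longleftrightarrow> (\<exists>\<delta> \<theta>. covers A \<delta> \<theta> \<and> U \<in> Min_sets A \<delta> \<theta>)"

(* lower_central G i is the (i+1)-st term of the lower central series. *)
primrec lower_central :: "('g, 'm) monoid_scheme \<Rightarrow> nat \<Rightarrow> 'g set" where
  "lower_central G 0 = carrier G"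
| "lower_central G (Suc i) =
     generate G (\<Union>x\<in>lower_central G i. \<Union>y\<in>carrier G.
       {x \<otimes>\<^bsub>G\<^esub> y \<otimes>\<^bsub>G\<^esub> inv\<^bsub>G\<^esub> x \<otimes>\<^bsub>G\<^esub> inv\<^bsub>G\<^esub> y})"

definition nilpotent_group_class_le :: "('g, 'm) monoid_scheme \<Rightarrow> nat \<Rightarrow> bool" where
  "nilpotent_group_class_le G k \<longleftrightarrow> group G \<and> lower_central G k = {\<one>\<^bsub>G\<^esub>}"

definition acts_as_nilpotent_group :: "('a \<Rightarrow> 'a) set \<Rightarrow> 'a set \<Rightarrow> nat \<Rightarrow> bool" where
  "acts_as_nilpotent_group T U k \<longleftrightarrow>
     T \<subseteq> Bij U \<and> nilpotent_group_class_le (BijGroup U\<lparr>carrier := T\<rparr>) k"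

end

theory Submission
  imports Defs
begin

text \<open>A snag is a failure of the supernilpotence condition once its coordinates are flipped so that
  the exceptional entry sits at the top vertex.

  Let \<open>U = r(A)\<close> with \<open>r\<close> idempotent. A non-injective twin of the identity on \<open>U\<close> has an
  idempotent power \<open>q \<noteq> id\<close>, and for \<open>y = q x \<noteq> x\<close> iterating the twin family yields a snag \<open>(y, x)\<close> of every
  dimension. So without snags the twins are permutations, their inverses are powers and hence
  polynomial, and an \<open>n\<close>-fold commutator of them is the top vertex of an \<open>n\<close>-dimensional cube of unary
  polynomials whose other vertices are the identity; if it moves \<open>x\<close>, evaluation at \<open>x\<close> is a snag.

  For a cover \<open>\<delta> \<prec> \<theta>\<close> with minimal set \<open>U\<close>, the twin group is a nilpotent normal subgroup of the
  group of polynomial permutations of \<open>U\<close>, which acts primitively on the \<open>\<delta>\<close>-classes of a \<open>\<theta>\<close>-block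
  of \<open>U\<close>; hence a twin fixing one such class fixes all of them. Connect two \<open>\<theta>\<close>-related parameter tuples by a chain
  of links \<open>(h u, h v)\<close> with \<open>u, v \<in> U\<close>. Along each link a pair of \<open>\<beta>\<close>-twins either collapses modulo
  \<open>\<delta>\<close> or differs by a member of the twin group; members for adjacent links agree at a point, hence
  modulo \<open>\<delta>\<close> on the whole block. So one member of the twin group carries the first row of a
  \<open>\<beta>,\<theta>\<close>-matrix to the second, which gives both centrality relations.

  Finally, centrality along covers makes both commutator sequences strictly decreasing.\<close>

section \<open>Generated algebras of maps\<close>

text \<open>The subalgebra of a power of \<open>A\<close> generated by \<open>G\<close>, indexed by
  the argument type. Polynomials, matrices and twin families are all instances, so closure
  properties are proved only once.\<close>

inductive_set Clo :: "('s, 'a) ualgebra \<Rightarrow> ('i \<Rightarrow> 'a) set \<Rightarrow> ('i \<Rightarrow> 'a) set"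
  for A :: "('s, 'a) ualgebra" and G :: "('i \<Rightarrow> 'a) set" where
  gen: "g \<in> G \<Longrightarrow> g \<in> Clo A G"
| app: "s \<in> symbols A \<Longrightarrow> length fs = arity A s \<Longrightarrow> \<forall>f\<in>set fs. f \<in> Clo A G \<Longrightarrow>
    (\<lambda>i. interp A s (map (\<lambda>f. f i) fs)) \<in> Clo A G"

abbreviation const_maps :: "('i \<Rightarrow> 'a) set" where
  "const_maps \<equiv> range (\<lambda>c _. c)"

text \<open>Reindexing along \<open>\<phi>\<close> is a homomorphism between powers of
  \<open>A\<close>, so only generators have to be checked.\<close>

lemma Clo_subst:
  assumes "F \<in> Clo A G" and "\<And>g. g \<in> G \<Longrightarrow> (\<lambda>i. g (\<phi> i)) \<in> Clo A H"
  shows "(\<lambda>i. F (\<phi> i)) \<in> Clo A H"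
  using assms(1)
proof induction
  case (gen g)
  then show ?case by (rule assms(2))
next
  case (app s fs)
  have "(\<lambda>i. interp A s (map (\<lambda>f. f i) (map (\<lambda>f i. f (\<phi> i)) fs))) \<in> Clo A H"
    using app by (intro Clo.app) auto
  then show ?case by (simp add: comp_def)
qed

text \<open>The maps that factor through \<open>\<phi>\<close> form a subalgebra; the induction
  chooses one factor for every argument of the operation.\<close>

lemma Clo_factor:
  assumes "F \<in> Clo A G" and "\<And>g. g \<in> G \<Longrightarrow> \<exists>h\<in>Clo A H. g = (\<lambda>i. h (\<phi> i))"
  shows "\<exists>h\<in>Clo A H. F = (\<lambda>i. h (\<phi> i))"
  using assms(1)
proof induction
  case (gen g)
  then show ?case by (rule assms(2))
next
  case (app s fs)
  then obtain h where h: "\<forall>f\<in>set fs. h f \<in> Clo A H \<and> f = (\<lambda>i. h f (\<phi> i))"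
    by metis
  have mem: "(\<lambda>i. interp A s (map (\<lambda>f. f i) (map h fs))) \<in> Clo A H"
    using app(1,2) h by (intro Clo.app) auto
  have "(\<lambda>i. interp A s (map (\<lambda>f. f i) fs)) =
      (\<lambda>i. interp A s (map (\<lambda>f. f (\<phi> i)) (map h fs)))"
  proof
    fix i
    have "f i = h f (\<phi> i)" if "f \<in> set fs" for f
      using h that by (metis (lifting))
    then have "map (\<lambda>f. f i) fs = map (\<lambda>f. f (\<phi> i)) (map h fs)"
      by simp
    then show "interp A s (map (\<lambda>f. f i) fs) = interp A s (map (\<lambda>f. f (\<phi> i)) (map h fs))"
      by (rule arg_cong)
  qed
  then show ?case by (intro bexI[OF _ mem])
qed

lemma Clo_mono: "F \<in> Clo A G \<Longrightarrow> G \<subseteq> H \<Longrightarrow> F \<in> Clo A H"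
  using Clo_subst[of F A G "\<lambda>i. i" H] by (auto intro: Clo.gen)

lemma Clo_Con:
  assumes "F \<in> Clo A G" and "\<theta> \<in> Con A" and "\<And>g. g \<in> G \<Longrightarrow> (g i, g j) \<in> \<theta>"
  shows "(F i, F j) \<in> \<theta>"
  using assms(1)
proof induction
  case (gen g)
  then show ?case by (rule assms(3))
next
  case (app s fs)
  have "list_all2 (\<lambda>x y. (x, y) \<in> \<theta>) (map (\<lambda>f. f i) fs) (map (\<lambda>f. f j) fs)"
    using app by (auto simp: list_all2_conv_all_nth)
  then show ?case
    using assms(2) app(1,2) unfolding Con_def by auto
qed

lemma Clo_cong:
  assumes "F \<in> Clo A G" and "\<And>g. g \<in> G \<Longrightarrow> g i = g j"
  shows "F i = F j"
  using assms(1)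
proof induction
  case (gen g)
  then show ?case by (rule assms(2))
next
  case (app s fs)
  then have "map (\<lambda>f. f i) fs = map (\<lambda>f. f j) fs" by simp
  then show ?case by (rule arg_cong)
qed

section \<open>Polynomial operations as generated maps\<close>

lemma Pol_eq_Clo: "Pol A n = Clo A ({\<lambda>xs. xs ! i | i. i < n} \<union> const_maps)"
proof (intro equalityI subsetI)
  fix p assume "p \<in> Pol A n"
  then show "p \<in> Clo A ({\<lambda>xs. xs ! i | i. i < n} \<union> const_maps)"
    by induction (auto intro: Clo.intros)
next
  fix p :: "'a list \<Rightarrow> 'a" assume "p \<in> Clo A ({\<lambda>xs. xs ! i | i. i < n} \<union> const_maps)"
  then show "p \<in> Pol A n"
    by induction (auto intro: Pol.intros)
qed

lemma Pol_subst:
  assumes "p \<in> Pol A n" and "\<And>j. j < n \<Longrightarrow> (\<lambda>i. \<phi> i ! j) \<in> Clo A G" and "const_maps \<subseteq> G"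
  shows "(\<lambda>i. p (\<phi> i)) \<in> Clo A G"
  using assms(1) unfolding Pol_eq_Clo
  by (rule Clo_subst) (use assms(2,3) in \<open>auto intro: Clo.gen\<close>)

text \<open>Recovers an explicit polynomial from a generated map: the tuple \<open>\<phi>\<close>
  lists the nonconstant generators and the polynomial absorbs the constants. The definitions of
  matrices and twins ask for such polynomials.\<close>

lemma Pol_factor:
  assumes "F \<in> Clo A G" and "\<And>g. g \<in> G \<Longrightarrow> g \<in> const_maps \<or> (\<exists>j<n. g = (\<lambda>i. \<phi> i ! j))"
  shows "\<exists>p\<in>Pol A n. F = (\<lambda>i. p (\<phi> i))"
  unfolding Pol_eq_Clo
proof (rule Clo_factor[OF assms(1)])
  fix g assume "g \<in> G"
  from assms(2)[OF this] consider c where "g = (\<lambda>_. c)" | j where "j < n" "g = (\<lambda>i. \<phi> i ! j)"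
    by blast
  then show "\<exists>h\<in>Clo A ({\<lambda>xs. xs ! i | i. i < n} \<union> const_maps). g = (\<lambda>i. h (\<phi> i))"
  proof cases
    case 1
    then show ?thesis by (intro bexI[of _ "\<lambda>_. c"]) (auto intro: Clo.gen)
  next
    case 2
    then show ?thesis by (intro bexI[of _ "\<lambda>xs. xs ! j"]) (auto intro: Clo.gen)
  qed
qed

lemma Pol1_eq_Clo: "Pol1 A = Clo A (insert (\<lambda>x. x) const_maps)"
proof (intro equalityI subsetI)
  fix f assume "f \<in> Pol1 A"
  then obtain p where p: "p \<in> Pol A 1" and f: "f = (\<lambda>x. p [x])"
    unfolding Pol1_def by auto
  show "f \<in> Clo A (insert (\<lambda>x. x) const_maps)"
    unfolding f by (rule Pol_subst[OF p]) (auto intro: Clo.gen)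
next
  fix f :: "'a \<Rightarrow> 'a" assume "f \<in> Clo A (insert (\<lambda>x. x) const_maps)"
  then have "\<exists>p\<in>Pol A 1. f = (\<lambda>x. p [x])"
    by (rule Pol_factor) auto
  then show "f \<in> Pol1 A" unfolding Pol1_def by auto
qed

lemma Pol1_comp_Clo:
  assumes "p \<in> Pol1 A" and "F \<in> Clo A G" and "const_maps \<subseteq> G"
  shows "(\<lambda>i. p (F i)) \<in> Clo A G"
  using assms(1) unfolding Pol1_eq_Clo
  by (rule Clo_subst) (use assms(2,3) in \<open>auto intro: Clo.gen\<close>)

lemma Pol1_id: "(\<lambda>x. x) \<in> Pol1 A"
  unfolding Pol1_eq_Clo by (rule Clo.gen) simp

lemma Pol1_comp: "p \<in> Pol1 A \<Longrightarrow> q \<in> Pol1 A \<Longrightarrow> (\<lambda>x. p (q x)) \<in> Pol1 A"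
  using Pol1_comp_Clo[of p A q "insert (\<lambda>x. x) const_maps"] unfolding Pol1_eq_Clo by auto

lemma Pol1_funpow: "p \<in> Pol1 A \<Longrightarrow> p ^^ n \<in> Pol1 A"
proof (induction n)
  case 0
  then show ?case using Pol1_id by (simp add: id_def)
next
  case (Suc n)
  then show ?case using Pol1_comp[of p A "p ^^ n"] by (simp add: comp_def)
qed

lemma Con_equivD:
  assumes "\<theta> \<in> Con A"
  shows Con_refl: "(x, x) \<in> \<theta>"
    and Con_sym: "(x, y) \<in> \<theta> \<Longrightarrow> (y, x) \<in> \<theta>"
    and Con_trans: "(x, y) \<in> \<theta> \<Longrightarrow> (y, z) \<in> \<theta> \<Longrightarrow> (x, z) \<in> \<theta>"
  using assms unfolding Con_def equiv_def refl_on_def sym_def trans_def by blast+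

lemma Pol1_Con: "p \<in> Pol1 A \<Longrightarrow> \<theta> \<in> Con A \<Longrightarrow> (x, y) \<in> \<theta> \<Longrightarrow> (p x, p y) \<in> \<theta>"
  unfolding Pol1_eq_Clo by (erule Clo_Con) (auto intro: Con_refl)

section \<open>Matrices, twins and families of unary polynomials\<close>

text \<open>Vertices of the cube are maps \<open>nat \<Rightarrow> bool\<close> of which only the first
  \<open>length \<alpha>s\<close> values matter; \<open>\<pi>\<close> extracts the vertex from an index.\<close>

definition edge_maps :: "'a rel list \<Rightarrow> ('i \<Rightarrow> nat \<Rightarrow> bool) \<Rightarrow> ('i \<Rightarrow> 'a) set" where
  "edge_maps \<alpha>s \<pi> = const_maps \<union>
     {\<lambda>i. if \<pi> i j then y else x | j x y. j < length \<alpha>s \<and> (x, y) \<in> \<alpha>s ! j}"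

lemma const_maps_edge_maps [simp]: "const_maps \<subseteq> edge_maps \<alpha>s \<pi>"
  unfolding edge_maps_def by blast

lemma const_edge_maps [simp]: "(\<lambda>_. c) \<in> edge_maps \<alpha>s \<pi>"
  unfolding edge_maps_def by blast

lemma edge_mapsI: "j < length \<alpha>s \<Longrightarrow> (x, y) \<in> \<alpha>s ! j \<Longrightarrow>
    (\<lambda>i. if \<pi> i j then y else x) \<in> edge_maps \<alpha>s \<pi>"
  unfolding edge_maps_def by blast

lemma edge_mapsE:
  assumes "g \<in> edge_maps \<alpha>s \<pi>"
  obtains (const) c where "g = (\<lambda>_. c)"
  | (edge) j x y where "j < length \<alpha>s" "(x, y) \<in> \<alpha>s ! j" "g = (\<lambda>i. if \<pi> i j then y else x)"
  using assms unfolding edge_maps_def by blast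

text \<open>Matrices without a chosen polynomial or parameter tuples: the generators are the
  constants and the single edges, each depending on one direction.\<close>

definition Mat :: "('s, 'a) ualgebra \<Rightarrow> 'a rel list \<Rightarrow> ((nat \<Rightarrow> bool) \<Rightarrow> 'a) set" where
  "Mat A \<alpha>s = Clo A (edge_maps \<alpha>s (\<lambda>e. e))"

text \<open>Cubes of unary polynomials: an index pairs a vertex with an argument, and the generator
  \<open>snd\<close> is the variable.\<close>

definition Fam :: "('s, 'a) ualgebra \<Rightarrow> 'a rel list \<Rightarrow> ((nat \<Rightarrow> bool) \<times> 'a \<Rightarrow> 'a) set" where
  "Fam A \<alpha>s = Clo A (insert snd (edge_maps \<alpha>s fst))"

text \<open>Block lengths do not depend on the vertex, so a position always falls in the same place
  of the same block. Having \<open>i\<close> and \<open>l\<close> chosen before \<open>e\<close> is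
  what makes each entry a single edge map.\<close>

lemma nth_concat_blocks:
  fixes a :: "nat \<Rightarrow> 'b \<Rightarrow> 'a list"
  assumes "\<And>i b. i < n \<Longrightarrow> length (a i b) = L i" and "j < (\<Sum>i<n. L i)"
  shows "\<exists>i<n. \<exists>l<L i. \<forall>e. concat (map (\<lambda>i. a i (e i)) [0..<n]) ! j = a i (e i) ! l"
  using assms
proof (induction n)
  case 0
  then show ?case by simp
next
  case (Suc n)
  have len: "length (concat (map (\<lambda>i. a i (e i)) [0..<n])) = (\<Sum>i<n. L i)" for e
    using Suc.prems(1)
    by (simp add: length_concat comp_def interv_sum_list_conv_sum_set_nat atLeast0LessThan)
  show ?case
  proof (cases "j < (\<Sum>i<n. L i)")
    case True
    with Suc obtain i l where "i < n" "l < L i"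
      "\<forall>e. concat (map (\<lambda>i. a i (e i)) [0..<n]) ! j = a i (e i) ! l"
      by (metis less_SucI)
    then show ?thesis
      using True by (intro exI[of _ i] conjI exI[of _ l]) (auto simp: nth_append len)
  next
    case False
    then show ?thesis
      using Suc.prems(2)
      by (intro exI[of _ n] conjI exI[of _ "j - (\<Sum>i<n. L i)"]) (auto simp: nth_append len)
  qed
qed

lemma nth_concat_block_position:
  fixes a :: "nat \<Rightarrow> 'b \<Rightarrow> 'a list"
  assumes "\<And>i b. i < n \<Longrightarrow> length (a i b) = L i" and "i < n" and "l < L i"
  shows "\<exists>j<\<Sum>i<n. L i. \<forall>e. concat (map (\<lambda>i. a i (e i)) [0..<n]) ! j = a i (e i) ! l"
  using assms
proof (induction n)
  case 0
  then show ?case by simp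
next
  case (Suc n)
  have len: "length (concat (map (\<lambda>i. a i (e i)) [0..<n])) = (\<Sum>i<n. L i)" for e
    using Suc.prems(1)
    by (simp add: length_concat comp_def interv_sum_list_conv_sum_set_nat atLeast0LessThan)
  show ?case
  proof (cases "i < n")
    case True
    with Suc obtain j where "j < (\<Sum>i<n. L i)"
      "\<forall>e. concat (map (\<lambda>i. a i (e i)) [0..<n]) ! j = a i (e i) ! l"
      by (metis less_SucI)
    then show ?thesis
      by (intro exI[of _ j] conjI) (auto simp: nth_append len)
  next
    case False
    then have "i = n" using Suc.prems by simp
    then show ?thesis
      using Suc.prems
      by (intro exI[of _ "(\<Sum>i<n. L i) + l"] conjI) (auto simp: nth_append len)
  qed
qed

lemma list_all2_pairs:
  "set ps \<subseteq> R \<Longrightarrow> list_all2 (\<lambda>x y. (x, y) \<in> R) (map fst ps) (map snd ps)"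
  by (induction ps) auto

text \<open>In one direction each entry of the concatenated tuple is an edge map. In the other,
  finiteness lets one pair of tuples list a whole relation, so every edge map is a coordinate of the
  concatenation.\<close>

lemma matrices_eq_Mat:
  fixes A :: "('s, 'a::finite) ualgebra"
  shows "matrices A \<alpha>s = (\<lambda>m. \<lambda>e\<in>cube (length \<alpha>s). m ((!) e)) ` Mat A \<alpha>s"
proof (intro equalityI subsetI)
  let ?n = "length \<alpha>s"
  fix m assume "m \<in> matrices A \<alpha>s"
  then obtain f a where m: "m = (\<lambda>e\<in>cube ?n. f (concat (map (\<lambda>i. a i (e ! i)) [0..<?n])))"
    and a: "\<And>i. i < ?n \<Longrightarrow> list_all2 (\<lambda>x y. (x, y) \<in> \<alpha>s ! i) (a i False) (a i True)"
    and f: "f \<in> Pol A (\<Sum>i<?n. length (a i False))"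
    unfolding matrices_def by blast
  have L: "length (a i b) = length (a i False)" if "i < ?n" for i b
    using a[OF that] by (cases b) (auto simp: list_all2_lengthD)
  let ?m = "\<lambda>e. f (concat (map (\<lambda>i. a i (e i)) [0..<?n]))"
  have "?m \<in> Mat A \<alpha>s"
    unfolding Mat_def
  proof (rule Pol_subst[OF f])
    fix j assume "j < (\<Sum>i<?n. length (a i False))"
    from nth_concat_blocks[of ?n a "\<lambda>i. length (a i False)", OF L this] obtain i l where
      il: "i < ?n" "l < length (a i False)"
        "\<forall>e. concat (map (\<lambda>i. a i (e i)) [0..<?n]) ! j = a i (e i) ! l"
      by auto
    have "(\<lambda>e. concat (map (\<lambda>i. a i (e i)) [0..<?n]) ! j) =
        (\<lambda>e. if e i then a i True ! l else a i False ! l)"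
      using il(3) by auto
    moreover have "(a i False ! l, a i True ! l) \<in> \<alpha>s ! i"
      using a[OF il(1)] il(2) by (auto simp: list_all2_conv_all_nth)
    ultimately show "(\<lambda>e. concat (map (\<lambda>i. a i (e i)) [0..<?n]) ! j)
        \<in> Clo A (edge_maps \<alpha>s (\<lambda>e. e))"
      using edge_mapsI[of i \<alpha>s _ _ "\<lambda>e. e"] il(1) by (auto intro: Clo.gen)
  qed simp
  then show "m \<in> (\<lambda>m. \<lambda>e\<in>cube ?n. m ((!) e)) ` Mat A \<alpha>s"
    unfolding m by (rule rev_image_eqI) auto
next
  let ?n = "length \<alpha>s"
  fix m' assume "m' \<in> (\<lambda>m. \<lambda>e\<in>cube ?n. m ((!) e)) ` Mat A \<alpha>s"
  then obtain m where m: "m \<in> Mat A \<alpha>s" and m': "m' = (\<lambda>e\<in>cube ?n. m ((!) e))"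
    by auto
  have "\<forall>i. \<exists>ps. set ps = \<alpha>s ! i"
    by (simp add: finite_list)
  then obtain ps where ps: "\<And>i. set (ps i) = \<alpha>s ! i"
    by metis
  define a where "a i b = map (if b then snd else fst) (ps i)" for i b
  let ?N = "\<Sum>i<?n. length (ps i)"
  have "\<exists>f\<in>Pol A ?N. m = (\<lambda>e. f (concat (map (\<lambda>i. a i (e i)) [0..<?n])))"
    using m unfolding Mat_def
  proof (rule Pol_factor)
    fix g :: "(nat \<Rightarrow> bool) \<Rightarrow> 'a" assume "g \<in> edge_maps \<alpha>s (\<lambda>e. e)"
    then show "g \<in> const_maps \<or>
        (\<exists>j<?N. g = (\<lambda>e. concat (map (\<lambda>i. a i (e i)) [0..<?n]) ! j))"
    proof (cases rule: edge_mapsE)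
      case (const c)
      then show ?thesis by blast
    next
      case (edge i x y)
      then obtain l where l: "l < length (ps i)" "ps i ! l = (x, y)"
        using ps[of i] by (metis in_set_conv_nth)
      from nth_concat_block_position[of ?n a "\<lambda>i. length (ps i)", OF _ edge(1) this(1)]
      obtain j where j: "j < ?N" "\<forall>e. concat (map (\<lambda>i. a i (e i)) [0..<?n]) ! j = a i (e i) ! l"
        by (auto simp: a_def)
      then have "g = (\<lambda>e. concat (map (\<lambda>i. a i (e i)) [0..<?n]) ! j)"
        using l edge(3) by (auto simp: a_def)
      with j(1) show ?thesis by blast
    qed
  qed
  then obtain f where f: "f \<in> Pol A ?N" "m = (\<lambda>e. f (concat (map (\<lambda>i. a i (e i)) [0..<?n])))"
    by blast
  have "\<forall>i<?n. list_all2 (\<lambda>x y. (x, y) \<in> \<alpha>s ! i) (a i False) (a i True)"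
    using list_all2_pairs[OF equalityD1[OF ps]] by (simp add: a_def)
  moreover have "f \<in> Pol A (\<Sum>i<?n. length (a i False))"
    using f(1) by (simp add: a_def)
  ultimately show "m' \<in> matrices A \<alpha>s"
    unfolding matrices_def m' f(2) by (intro CollectI exI[of _ f] exI[of _ a] conjI) auto
qed

text \<open>Twins are the two ends of a one-dimensional family. For the converse, all pairs of the
  finite relation \<open>\<beta>\<close> serve as parameters.\<close>

lemma twins_iff_Fam:
  fixes A :: "('s, 'a::finite) ualgebra"
  shows "twins A \<beta> f g \<longleftrightarrow>
    (\<exists>F\<in>Fam A [\<beta>]. f = (\<lambda>x. F (\<lambda>_. False, x)) \<and> g = (\<lambda>x. F (\<lambda>_. True, x)))"
proof
  assume "twins A \<beta> f g"
  then obtain as bs h where ab: "list_all2 (\<lambda>x y. (x, y) \<in> \<beta>) as bs"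
    and h: "h \<in> Pol A (Suc (length as))" "\<forall>x. f x = h (x # as)" "\<forall>x. g x = h (x # bs)"
    unfolding twins_def by blast
  let ?F = "\<lambda>i. h (snd i # (if fst i 0 then bs else as))"
  have "?F \<in> Fam A [\<beta>]"
    unfolding Fam_def
  proof (rule Pol_subst[OF h(1)])
    fix j assume "j < Suc (length as)"
    show "(\<lambda>i. (snd i # (if fst i 0 then bs else as)) ! j)
        \<in> Clo A (insert snd (edge_maps [\<beta>] fst))"
    proof (cases j)
      case 0
      then show ?thesis by (auto intro: Clo.gen)
    next
      case (Suc l)
      then have "(as ! l, bs ! l) \<in> \<beta>"
        using ab \<open>j < _\<close> by (auto simp: list_all2_conv_all_nth)
      then have mem: "(\<lambda>i. if fst i 0 then bs ! l else as ! l) \<in> edge_maps [\<beta>] fst"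
        using edge_mapsI[of 0 "[\<beta>]" _ _ fst] by simp
      have eq: "(\<lambda>i. (snd i # (if fst i 0 then bs else as)) ! j) =
          (\<lambda>i. if fst i 0 then bs ! l else as ! l)"
        using Suc by auto
      show ?thesis unfolding eq using mem by (intro Clo.gen insertI2)
    qed
  qed auto
  then show "\<exists>F\<in>Fam A [\<beta>]. f = (\<lambda>x. F (\<lambda>_. False, x)) \<and> g = (\<lambda>x. F (\<lambda>_. True, x))"
    using h(2,3) by (intro bexI[of _ ?F] conjI ext) simp_all
next
  assume "\<exists>F\<in>Fam A [\<beta>]. f = (\<lambda>x. F (\<lambda>_. False, x)) \<and> g = (\<lambda>x. F (\<lambda>_. True, x))"
  then obtain F where F: "F \<in> Fam A [\<beta>]"
    and fg: "f = (\<lambda>x. F (\<lambda>_. False, x))" "g = (\<lambda>x. F (\<lambda>_. True, x))"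
    by blast
  obtain ps where ps: "set ps = \<beta>"
    using finite_list[of \<beta>] by auto
  have "\<exists>h\<in>Pol A (Suc (length ps)).
      F = (\<lambda>i. h (snd i # (map (if fst i 0 then snd else fst) ps)))"
    using F unfolding Fam_def
  proof (rule Pol_factor)
    fix d :: "(nat \<Rightarrow> bool) \<times> 'a \<Rightarrow> 'a" assume "d \<in> insert snd (edge_maps [\<beta>] fst)"
    then consider "d = snd" | "d \<in> edge_maps [\<beta>] fst" by blast
    then show "d \<in> const_maps \<or>
        (\<exists>j<Suc (length ps). d = (\<lambda>i. (snd i # (map (if fst i 0 then snd else fst) ps)) ! j))"
    proof cases
      case 1
      then show ?thesis by auto
    next
      case 2
      then show ?thesis
      proof (cases rule: edge_mapsE)
        case (const c)
        then show ?thesis by blast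
      next
        case (edge i x y)
        then obtain l where "l < length ps" "ps ! l = (x, y)"
          using ps by (auto simp: in_set_conv_nth)
        then show ?thesis
          using edge by (intro disjI2 exI[of _ "Suc l"]) auto
      qed
    qed
  qed
  then obtain h where h: "h \<in> Pol A (Suc (length ps))"
    "F = (\<lambda>i. h (snd i # (map (if fst i 0 then snd else fst) ps)))" by blast
  have pol: "(\<lambda>x. F (e, x)) \<in> Pol1 A" for e
    unfolding Pol1_eq_Clo
    by (rule Clo_subst[OF F[unfolded Fam_def], of "\<lambda>x. (e, x)"])
      (auto elim!: edge_mapsE intro: Clo.gen)
  have "list_all2 (\<lambda>x y. (x, y) \<in> \<beta>) (map fst ps) (map snd ps)"
    using list_all2_pairs[OF equalityD1[OF ps]] .
  moreover have "F (\<lambda>_. False, x) = h (x # map fst ps)"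
    "F (\<lambda>_. True, x) = h (x # map snd ps)" for x
    using h(2) by simp_all
  ultimately have "\<exists>as bs. list_all2 (\<lambda>x y. (x, y) \<in> \<beta>) as bs \<and>
      (\<exists>h\<in>Pol A (Suc (length as)). (\<forall>x. f x = h (x # as)) \<and> (\<forall>x. g x = h (x # bs)))"
    unfolding fg by (metis h(1) length_map)
  then show "twins A \<beta> f g"
    unfolding twins_def using pol fg by blast
qed

lemma Mat_cong:
  assumes "m \<in> Mat A \<alpha>s" and "\<And>i. i < length \<alpha>s \<Longrightarrow> e i = e' i"
  shows "m e = m e'"
  using assms(1) unfolding Mat_def
  by (rule Clo_cong) (use assms(2) in \<open>auto elim!: edge_mapsE\<close>)

section \<open>Supernilpotence excludes snags\<close>

text \<open>Where \<open>c\<close> is false the direction is reversed, which swaps the ends of its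
  edges; symmetry of \<beta> keeps them admissible.\<close>

lemma Mat_flip:
  assumes "m \<in> Mat A (replicate n \<beta>)" and "\<beta> \<in> Con A"
  shows "(\<lambda>e. m (\<lambda>i. e i = c i)) \<in> Mat A (replicate n \<beta>)"
  unfolding Mat_def
proof (rule Clo_subst[OF assms(1)[unfolded Mat_def]])
  fix g :: "(nat \<Rightarrow> bool) \<Rightarrow> _" assume "g \<in> edge_maps (replicate n \<beta>) (\<lambda>e. e)"
  then show "(\<lambda>e. g (\<lambda>i. e i = c i)) \<in> Clo A (edge_maps (replicate n \<beta>) (\<lambda>e. e))"
  proof (cases rule: edge_mapsE)
    case (const c)
    then show ?thesis by (simp add: Clo.gen)
  next
    case (edge j x y)
    define a b where "a = (if c j then x else y)" and "b = (if c j then y else x)"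
    have "(a, b) \<in> \<beta>"
      using edge(1,2) assms(2) by (auto simp: a_def b_def intro: Con_sym)
    then have "(\<lambda>e. if e j then b else a) \<in> edge_maps (replicate n \<beta>) (\<lambda>e. e)"
      using edge(1) edge_mapsI[of j "replicate n \<beta>" a b "\<lambda>e. e"] by simp
    moreover have "(\<lambda>e. g (\<lambda>i. e i = c i)) = (\<lambda>e. if e j then b else a)"
      unfolding edge(3) by (auto simp: a_def b_def)
    ultimately show ?thesis by (metis (no_types) Clo.gen)
  qed
qed

lemma supernilpotent_no_snags:
  fixes A :: "('s, 'a::finite) ualgebra"
  assumes "supernilpotent A k \<beta>" and "\<beta> \<in> Con A"
  shows "snags A \<beta> (k + 1) = {}"
proof (rule equals0I)
  fix p assume "p \<in> snags A \<beta> (k + 1)"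
  then obtain u v m' e0 where uv: "u \<noteq> v" and m': "m' \<in> matrices A (replicate (k + 1) \<beta>)"
    and e0: "e0 \<in> cube (k + 1)" "m' e0 = v" "\<forall>e'\<in>cube (k + 1) - {e0}. m' e' = u"
    unfolding snags_def by blast
  obtain m where m: "m \<in> Mat A (replicate (k + 1) \<beta>)"
    and mm: "m' = (\<lambda>e\<in>cube (k + 1). m ((!) e))"
    using m' unfolding matrices_eq_Mat by auto
  \<comment> \<open>\<open>m2\<close> at \<open>e\<close> reads the vertex that agrees with
    \<open>e0\<close> exactly in the directions where \<open>e\<close> is true, so the exceptional
    entry moves to the all-true vertex.\<close>
  define m2 where "m2 = (\<lambda>e\<in>cube (k + 1). m (\<lambda>i. e ! i = e0 ! i))"
  have m2M: "m2 \<in> matrices A (replicate (k + 1) \<beta>)"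
    unfolding matrices_eq_Mat m2_def
    using Mat_flip[OF m assms(2), of "(!) e0"]
    by (auto intro!: image_eqI[where x = "\<lambda>e. m (\<lambda>i. e i = e0 ! i)"])
  have m2: "m2 e = m' (map (\<lambda>i. e ! i = e0 ! i) [0..<k + 1])" if "e \<in> cube (k + 1)" for e
  proof -
    have "m (\<lambda>i. e ! i = e0 ! i) = m ((!) (map (\<lambda>i. e ! i = e0 ! i) [0..<k + 1]))"
      by (rule Mat_cong[OF m]) (simp del: upt_Suc)
    then show ?thesis using that by (simp add: m2_def mm cube_def del: upt_Suc)
  qed
  have top: "m2 (replicate (k + 1) True) = v"
  proof -
    have "map (\<lambda>i. replicate (k + 1) True ! i = e0 ! i) [0..<k + 1] = e0"
      using e0(1) by (intro nth_equalityI) (auto simp: cube_def simp del: upt_Suc replicate_Suc)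
    then show ?thesis using m2[of "replicate (k + 1) True"] e0(2) by (simp add: cube_def)
  qed
  have rest: "m2 e = u" if e: "e \<in> cube (k + 1)" and ne: "e \<noteq> replicate (k + 1) True" for e
  proof -
    have "map (\<lambda>i. e ! i = e0 ! i) [0..<k + 1] \<noteq> e0"
    proof
      assume *: "map (\<lambda>i. e ! i = e0 ! i) [0..<k + 1] = e0"
      have "e ! i" if "i < k + 1" for i
        using arg_cong[OF *, of "\<lambda>xs. xs ! i"] that by (auto simp del: upt_Suc)
      then have "e = replicate (k + 1) True"
        using e by (intro nth_equalityI) (auto simp: cube_def simp del: replicate_Suc)
      then show False using ne by contradiction
    qed
    then show ?thesis using m2[OF e] e0(3) by (simp add: cube_def del: upt_Suc)
  qed
  have below: "m2 (e @ [c]) = u" if "e \<in> cube k" "e @ [c] \<noteq> replicate (k + 1) True" for e c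
    using that by (intro rest) (auto simp: cube_def)
  have last: "replicate (k + 1) True = replicate k True @ [True]"
    by (simp add: replicate_append_same)
  \<comment> \<open>Every pair below the top edge is \<open>(u, u)\<close>; centrality then equates
    the ends of the top edge, which are \<open>u\<close> and \<open>v\<close>.\<close>
  have "(m2 (e @ [False]), m2 (e @ [True])) \<in> Id" if "e \<in> cube k - {replicate k True}" for e
    using that below[of e False] below[of e True] unfolding last by simp
  then have "(m2 (replicate k True @ [False]), m2 (replicate k True @ [True])) \<in> Id"
    using assms(1) m2M unfolding supernilpotent_def centralizes_def
    unfolding length_replicate add_diff_cancel_right' by blast
  moreover have "m2 (replicate k True @ [False]) = u"
    by (rule below) (simp add: cube_def, simp only: last, simp)
  ultimately show False
    using top uv unfolding last by simp
qed

section \<open>Centrality along covers implies nilpotence\<close>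

lemma Con_Inter:
  assumes "S \<subseteq> Con A" and "S \<noteq> {}"
  shows "\<Inter>S \<in> Con A"
proof -
  have "equiv UNIV (\<Inter>S)"
  proof (rule equivI)
    show "refl (\<Inter>S)"
      using assms by (auto simp: refl_on_def intro: Con_refl)
    show "sym (\<Inter>S)"
      unfolding sym_def using assms(1) by (blast intro: Con_sym)
    show "trans (\<Inter>S)"
      unfolding trans_def using assms(1) by (blast intro: Con_trans)
  qed simp
  moreover have "(interp A s xs, interp A s ys) \<in> \<theta>"
    if "s \<in> symbols A" "length xs = arity A s" "\<theta> \<in> S"
      "list_all2 (\<lambda>x y. (x, y) \<in> \<Inter>S) xs ys" for s xs ys \<theta>
  proof -
    have "list_all2 (\<lambda>x y. (x, y) \<in> \<theta>) xs ys"
      by (rule list_all2_mono[OF that(4)]) (use that(3) in blast)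
    then show ?thesis using that assms(1) unfolding Con_def by blast
  qed
  ultimately show ?thesis unfolding Con_def by auto
qed

lemma UNIV_Con: "UNIV \<in> Con A"
  unfolding Con_def by (auto simp: equiv_def refl_on_def sym_def trans_def)

lemma Id_Con: "Id \<in> Con A"
  unfolding Con_def
  by (auto simp: equiv_def refl_on_def sym_def trans_def list_all2_conv_all_nth list_eq_iff_nth_eq
      intro!: arg_cong[where f = "interp A _"])

lemma centralizes_Inter:
  assumes "\<And>\<delta>. \<delta> \<in> S \<Longrightarrow> centralizes A \<alpha>s \<delta>"
  shows "centralizes A \<alpha>s (\<Inter>S)"
  using assms unfolding centralizes_def by (simp add: Ball_def)

text \<open>Centrality is preserved by intersections and holds for the full relation, so the least
  element in the definition exists.\<close>

lemma commutator_eq: "commutator A \<alpha>s = \<Inter>{\<delta> \<in> Con A. centralizes A \<alpha>s \<delta>}"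
  unfolding commutator_def
proof (rule Least_equality)
  let ?S = "{\<delta> \<in> Con A. centralizes A \<alpha>s \<delta>}"
  have "UNIV \<in> ?S"
    by (simp add: UNIV_Con centralizes_def)
  then show "\<Inter>?S \<in> Con A \<and> centralizes A \<alpha>s (\<Inter>?S)"
    by (intro conjI Con_Inter centralizes_Inter) blast+
qed blast

lemma commutator_Con: "commutator A \<alpha>s \<in> Con A"
proof -
  have "UNIV \<in> {\<delta> \<in> Con A. centralizes A \<alpha>s \<delta>}"
    by (simp add: UNIV_Con centralizes_def)
  then show ?thesis unfolding commutator_eq by (intro Con_Inter) blast+
qed

lemma commutator_subset: "\<delta> \<in> Con A \<Longrightarrow> centralizes A \<alpha>s \<delta> \<Longrightarrow> commutator A \<alpha>s \<subseteq> \<delta>"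
  unfolding commutator_eq by blast

lemma exists_lower_cover:
  fixes A :: "('s, 'a::finite) ualgebra"
  assumes "\<gamma> \<in> Con A" and "\<gamma> \<noteq> Id"
  shows "\<exists>\<delta>. covers A \<delta> \<gamma>"
proof -
  let ?S = "{\<delta> \<in> Con A. \<delta> \<subset> \<gamma>}"
  have "Id \<subset> \<gamma>"
    using assms Con_refl[OF assms(1)] by auto
  then have "?S \<noteq> {}" using Id_Con by blast
  moreover have "finite ?S" by simp
  ultimately obtain \<delta> where \<delta>: "\<delta> \<in> ?S" "\<forall>\<gamma>\<in>?S. \<delta> \<subseteq> \<gamma> \<longrightarrow> \<delta> = \<gamma>"
    using finite_has_maximal[of ?S] by blast
  then show ?thesis
    using assms(1) unfolding covers_def by blast
qed

text \<open>A strictly decreasing sequence of finite relations stops, and by assumption it can stop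
  only at equality.\<close>

lemma funpow_reaches_Id:
  fixes A :: "('s, 'a::finite) ualgebra"
  assumes "\<gamma> \<in> Con A"
    and "\<And>\<gamma>. \<gamma> \<in> Con A \<Longrightarrow> \<gamma> \<noteq> Id \<Longrightarrow> F \<gamma> \<in> Con A \<and> F \<gamma> \<subset> \<gamma>"
  shows "\<exists>n. (F ^^ n) \<gamma> = Id"
  using finite[of \<gamma>] assms(1)
proof (induction rule: finite_psubset_induct)
  case (psubset \<gamma>)
  show ?case
  proof (cases "\<gamma> = Id")
    case True
    then show ?thesis by (intro exI[of _ 0]) simp
  next
    case False
    with psubset assms(2)[of \<gamma>] obtain n where "(F ^^ n) (F \<gamma>) = Id" by blast
    then show ?thesis by (intro exI[of _ "Suc n"]) (simp add: funpow_swap1)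
  qed
qed

text \<open>For \<gamma> different from equality, centrality along a lower cover \<delta> of
  \<gamma> bounds both commutators of \<beta> and \<gamma> by \<delta>, so both sequences shrink
  strictly.\<close>

lemma nilpotent_of_central_covers:
  fixes A :: "('s, 'a::finite) ualgebra"
  assumes "\<beta> \<in> Con A"
    and C: "\<And>\<delta> \<theta>. covers A \<delta> \<theta> \<Longrightarrow> centralizes A [\<beta>, \<theta>] \<delta> \<and> centralizes A [\<theta>, \<beta>] \<delta>"
  shows "left_nilpotent A \<beta> \<and> right_nilpotent A \<beta>"
proof
  have "commutator A [\<beta>, \<gamma>] \<subset> \<gamma> \<and> commutator A [\<gamma>, \<beta>] \<subset> \<gamma>"
    if "\<gamma> \<in> Con A" "\<gamma> \<noteq> Id" for \<gamma>
  proof -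
    obtain \<delta> where \<delta>: "covers A \<delta> \<gamma>" using exists_lower_cover \<open>\<gamma> \<in> Con A\<close> \<open>\<gamma> \<noteq> Id\<close> by blast
    then have "\<delta> \<in> Con A" "\<delta> \<subset> \<gamma>" unfolding covers_def by auto
    with C[OF \<delta>] commutator_subset show ?thesis by blast
  qed
  then have "\<exists>n. ((\<lambda>\<gamma>. commutator A [\<beta>, \<gamma>]) ^^ n) \<beta> = Id"
    "\<exists>n. ((\<lambda>\<gamma>. commutator A [\<gamma>, \<beta>]) ^^ n) \<beta> = Id"
    by (intro funpow_reaches_Id[OF assms(1)] conjI commutator_Con; simp)+
  \<comment> \<open>Powers are indexed from 1, so the \<open>n\<close>-th iterate is the power with
    index \<open>n + 1\<close>.\<close>
  then show "left_nilpotent A \<beta>" "right_nilpotent A \<beta>"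
    unfolding left_nilpotent_def right_nilpotent_def left_power_def right_power_def
    by (metis diff_Suc_1 le_add1 plus_1_eq_Suc)+
qed

section \<open>Minimal sets\<close>

lemma translation_Pol1:
  assumes "s \<in> symbols A" and "length xs = arity A s"
  shows "(\<lambda>x. interp A s (xs[i := x])) \<in> Pol1 A"
proof -
  let ?fs = "(map (\<lambda>c _. c) xs)[i := \<lambda>x. x]"
  have "(\<lambda>x. interp A s (map (\<lambda>f. f x) ?fs)) \<in> Clo A (insert (\<lambda>x. x) const_maps)"
    using assms by (intro Clo.app) (auto dest!: set_update_subset_insert[THEN subsetD] intro!: Clo.gen)
  then show ?thesis
    unfolding Pol1_eq_Clo by (simp add: map_update comp_def)
qed

text \<open>The arguments of a basic operation are exchanged one at a time; each exchange is an
  instance of a unary polynomial.\<close>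

lemma Con_if_translations:
  assumes "equiv UNIV R" and "\<And>p x y. p \<in> Pol1 A \<Longrightarrow> (x, y) \<in> R \<Longrightarrow> (p x, p y) \<in> R"
  shows "R \<in> Con A"
proof -
  have "(interp A s xs, interp A s ys) \<in> R"
    if s: "s \<in> symbols A" "length xs = arity A s" and xy: "list_all2 (\<lambda>x y. (x, y) \<in> R) xs ys" for s xs ys
  proof -
    have equiv_trans: "\<And>x y z. (x, y) \<in> R \<Longrightarrow> (y, z) \<in> R \<Longrightarrow> (x, z) \<in> R"
      using assms(1) unfolding equiv_def trans_def by blast
    have len: "length ys = length xs" using xy by (simp add: list_all2_lengthD)
    have "(interp A s xs, interp A s (take n ys @ drop n xs)) \<in> R" if "n \<le> length xs" for n
      using that
    proof (induction n)
      case 0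
      then show ?case using assms(1) by (simp add: equiv_def refl_on_def)
    next
      case (Suc n)
      let ?zs = "take n ys @ drop n xs"
      have "(xs ! n, ys ! n) \<in> R"
        using xy Suc.prems by (simp add: list_all2_conv_all_nth)
      moreover have "length ?zs = arity A s" using len s(2) Suc.prems by simp
      ultimately have "(interp A s (?zs[n := xs ! n]), interp A s (?zs[n := ys ! n])) \<in> R"
        using assms(2)[OF translation_Pol1[OF s(1)]] by blast
      moreover have "?zs[n := xs ! n] = ?zs"
        using Suc.prems len by (simp add: list_update_append Cons_nth_drop_Suc[symmetric])
      moreover have "?zs[n := ys ! n] = take (Suc n) ys @ drop (Suc n) xs"
        using Suc.prems len
        by (simp add: list_update_append Cons_nth_drop_Suc[symmetric] take_Suc_conv_app_nth)
      ultimately have "(interp A s ?zs, interp A s (take (Suc n) ys @ drop (Suc n) xs)) \<in> R"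
        by simp
      moreover have "(interp A s xs, interp A s ?zs) \<in> R" using Suc.IH Suc.prems by simp
      ultimately show ?case
        using equiv_trans by blast
    qed
    from this[of "length xs"] show ?thesis using len by simp
  qed
  then show ?thesis using assms(1) unfolding Con_def by blast
qed

text \<open>The right-hand side is the congruence generated by \<delta> and \<open>(u, v)\<close>,
  written with Maltsev chains. It lies strictly above \<delta> and inside \<theta>, so it must be
  all of \<theta>.\<close>

lemma covers_chain:
  assumes "covers A \<delta> \<theta>" and "(u, v) \<in> \<theta>" and "(u, v) \<notin> \<delta>"
  shows "\<theta> = (\<delta> \<union> {(h u, h v) | h. h \<in> Pol1 A} \<union> {(h v, h u) | h. h \<in> Pol1 A})\<^sup>*"
    (is "_ = ?L\<^sup>*")
proof -
  have con: "\<delta> \<in> Con A" "\<theta> \<in> Con A" using assms(1) unfolding covers_def by auto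
  have "sym ?L"
    using Con_sym[OF con(1)] unfolding sym_def by blast
  then have "equiv UNIV (?L\<^sup>*)"
    by (intro equivI refl_rtrancl sym_rtrancl trans_rtrancl) auto
  moreover have "(p x, p y) \<in> ?L\<^sup>*" if p: "p \<in> Pol1 A" and "(x, y) \<in> ?L\<^sup>*" for p x y
    using that(2)
  proof induction
    case base
    then show ?case by simp
  next
    case (step y z)
    from step(2) consider "(y, z) \<in> \<delta>"
      | h where "h \<in> Pol1 A" "y = h u" "z = h v" | h where "h \<in> Pol1 A" "y = h v" "z = h u"
      by blast
    then have "(p y, p z) \<in> ?L"
    proof cases
      case 1
      then show ?thesis using Pol1_Con[OF p con(1)] by simp
    next
      case (2 h)
      then show ?thesis using Pol1_comp[OF p, of h] by auto
    next
      case (3 h)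
      then show ?thesis using Pol1_comp[OF p, of h] by auto
    qed
    with step(3) show ?case by (rule rtrancl_into_rtrancl)
  qed
  ultimately have R: "?L\<^sup>* \<in> Con A" by (rule Con_if_translations)
  have "?L \<subseteq> \<theta>"
    using Pol1_Con[OF _ con(2) assms(2)] Pol1_Con[OF _ con(2) Con_sym[OF con(2) assms(2)]] assms(1)
    unfolding covers_def by blast
  then have sub: "?L\<^sup>* \<subseteq> \<theta>"
  proof (intro subrelI)
    fix x y assume "(x, y) \<in> ?L\<^sup>*" and "?L \<subseteq> \<theta>"
    then show "(x, y) \<in> \<theta>"
      by (induction) (auto intro: Con_refl[OF con(2)] Con_trans[OF con(2)])
  qed
  have "(u, v) \<in> ?L" using Pol1_id[of A] by (auto intro!: exI[of _ "\<lambda>x. x"])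
  then have "\<delta> \<subset> ?L\<^sup>*" using assms(3) by blast
  then show ?thesis using assms(1) sub R unfolding covers_def by blast
qed

text \<open>One exponent serves all self-maps of the universe, so the members of a family can be
  iterated equally often and still form a family.\<close>

lemma exists_idempotent_power:
  "\<exists>N\<ge>1. \<forall>(f :: 'a::finite \<Rightarrow> 'a) x. (f ^^ N) ((f ^^ N) x) = (f ^^ N) x"
proof -
  have "\<exists>n\<ge>1. f ^^ (n + n) = f ^^ n" for f :: "'a \<Rightarrow> 'a"
  proof -
    have "\<not> inj (\<lambda>n. f ^^ n)"
      using finite_imageD[of "\<lambda>n. f ^^ n" UNIV] infinite_UNIV_nat by auto
    then obtain a b where ab: "a < b" "f ^^ a = f ^^ b"
      unfolding inj_def by (metis linorder_neqE_nat)
    define p where "p = b - a"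
    have p: "p \<ge> 1" using ab by (simp add: p_def)
    have step: "f ^^ (c + p) = f ^^ c" if "c \<ge> a" for c
    proof -
      have "f ^^ (c + p) = f ^^ (c - a) \<circ> f ^^ b"
        using that ab(1) by (simp add: p_def funpow_add[symmetric])
      also have "\<dots> = f ^^ (c - a) \<circ> f ^^ a" by (simp add: ab(2))
      also have "\<dots> = f ^^ c" using that by (simp add: funpow_add[symmetric])
      finally show ?thesis .
    qed
    have mult: "f ^^ (c + j * p) = f ^^ c" if "c \<ge> a" for c j
      using that
    proof (induction j)
      case (Suc j)
      then show ?case using step[of "c + j * p"] by (simp add: algebra_simps)
    qed simp
    \<comment> \<open>A positive multiple of the period \<open>p\<close> that is at least the
      preperiod \<open>a\<close>, so doubling this exponent changes nothing.\<close>
    let ?n = "Suc a * p"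
    have "?n \<ge> a" using p by (metis Suc_leD le_trans mult.right_neutral mult_le_mono2)
    then show ?thesis
      using mult[of ?n "Suc a"] p by (intro exI[of _ ?n]) auto
  qed
  then obtain n where n: "\<And>f :: 'a \<Rightarrow> 'a. n f \<ge> 1 \<and> f ^^ (n f + n f) = f ^^ n f" by metis
  \<comment> \<open>Each \<open>n f\<close> divides the product, and its positive multiples all give
    the same power of \<open>f\<close>.\<close>
  let ?N = "\<Prod>f\<in>UNIV. n f"
  have "(f ^^ ?N) ((f ^^ ?N) x) = (f ^^ ?N) x" for f :: "'a \<Rightarrow> 'a" and x
  proof -
    have "n f dvd ?N" by (rule dvd_prodI) auto
    then obtain c where c: "?N = n f * c" by blast
    have *: "f ^^ (n f * Suc d) = f ^^ n f" for d
    proof (induction d)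
      case (Suc d)
      have "f ^^ (n f * Suc (Suc d)) = f ^^ n f \<circ> f ^^ (n f * Suc d)"
        by (simp add: funpow_add[symmetric])
      also have "\<dots> = f ^^ n f"
        using n[of f] by (simp only: Suc funpow_add[symmetric])
      finally show ?case .
    qed simp
    have "?N \<noteq> 0" using n by (simp add: Suc_le_eq)
    then have "c \<noteq> 0" using c by auto
    then have "f ^^ ?N = f ^^ n f" using * c by (metis not0_implies_Suc)
    then show ?thesis using n[of f] by (metis comp_apply funpow_add)
  qed
  moreover have "?N \<ge> 1" using n by (intro prod_ge_1) auto
  ultimately show ?thesis by (intro exI[of _ ?N]) simp
qed

lemma Min_sets_image:
  "U \<in> Min_sets A \<delta> \<theta> \<Longrightarrow> \<exists>f. f \<in> Pol1 A \<and> range f = U \<and> \<not> map_prod f f ` \<theta> \<subseteq> \<delta>"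
  unfolding Min_sets_def Let_def by blast

lemma Min_sets_minimal:
  assumes "U \<in> Min_sets A \<delta> \<theta>" and "g \<in> Pol1 A" and "(x, y) \<in> \<theta>" and "(g x, g y) \<notin> \<delta>"
    and "range g \<subseteq> U"
  shows "range g = U"
proof -
  let ?S = "{range f | f. f \<in> Pol1 A \<and> \<not> map_prod f f ` \<theta> \<subseteq> \<delta>}"
  have "\<not> map_prod g g ` \<theta> \<subseteq> \<delta>" using assms(3,4) by auto
  then have "range g \<in> ?S" using assms(2) by auto
  moreover have "\<forall>V\<in>?S. V \<subseteq> U \<longrightarrow> V = U"
    using assms(1) unfolding Min_sets_def Let_def by simp
  ultimately show ?thesis using assms(5) by blast
qed

text \<open>For \<open>f\<close> with image \<open>U\<close> and a suitable \<open>h\<close>,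
  minimality makes the composite \<open>g\<close> of \<open>f\<close> after \<open>h\<close> map
  \<open>U\<close> onto \<open>U\<close>; an idempotent power of \<open>g\<close> is then the
  identity on \<open>U\<close>.\<close>

lemma Min_sets_idempotent:
  fixes A :: "('s, 'a::finite) ualgebra"
  assumes cov: "covers A \<delta> \<theta>" and U: "U \<in> Min_sets A \<delta> \<theta>"
  shows "\<exists>e\<in>Pol1 A. range e = U \<and> (\<forall>x\<in>U. e x = x)"
proof -
  have con: "\<delta> \<in> Con A" "\<theta> \<in> Con A" using cov unfolding covers_def by auto
  obtain f where f: "f \<in> Pol1 A" "range f = U" "\<not> map_prod f f ` \<theta> \<subseteq> \<delta>"
    using Min_sets_image[OF U] by auto
  obtain x y where xy: "(x, y) \<in> \<theta>" "(f x, f y) \<notin> \<delta>" using f(3) by auto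
  have "\<exists>h\<in>Pol1 A. (f (h (f x)), f (h (f y))) \<notin> \<delta>"
  proof (rule ccontr)
    assume "\<not> ?thesis"
    then have coll: "\<And>h. h \<in> Pol1 A \<Longrightarrow> (f (h (f x)), f (h (f y))) \<in> \<delta>" by blast
    have "(f x, f y) \<in> \<theta>" using Pol1_Con[OF f(1) con(2) xy(1)] .
    \<comment> \<open>The pair \<open>(f x, f y)\<close> and \<delta> generate \<theta>. If
      \<open>f\<close> collapsed all polynomial images of this pair, it would collapse every link of
      a chain from \<open>x\<close> to \<open>y\<close>.\<close>
    from covers_chain[OF cov this xy(2)] xy(1)
    have "(x, y) \<in> (\<delta> \<union> {(h (f x), h (f y)) | h. h \<in> Pol1 A} \<union> {(h (f y), h (f x)) | h. h \<in> Pol1 A})\<^sup>*"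
      by simp
    then have "(f x, f y) \<in> \<delta>"
    proof induction
      case base
      then show ?case by (rule Con_refl[OF con(1)])
    next
      case (step z w)
      then have "(f z, f w) \<in> \<delta>"
        using Pol1_Con[OF f(1) con(1)] coll Con_sym[OF con(1)] by blast
      with step(3) show ?case by (rule Con_trans[OF con(1)])
    qed
    then show False using xy(2) by contradiction
  qed
  then obtain h where h: "h \<in> Pol1 A" "(f (h (f x)), f (h (f y))) \<notin> \<delta>" by blast
  define g where "g = (\<lambda>x. f (h x))"
  have g: "g \<in> Pol1 A" unfolding g_def by (rule Pol1_comp[OF f(1) h(1)])
  have "range (\<lambda>x. g (f x)) = U"
  proof (rule Min_sets_minimal[OF U Pol1_comp[OF g f(1)] xy(1)])
    show "(g (f x), g (f y)) \<notin> \<delta>" using h(2) unfolding g_def .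
    show "range (\<lambda>x. g (f x)) \<subseteq> U" using f(2) by (auto simp: g_def)
  qed
  then have gU: "g ` U = U" using f(2) by (metis image_image)
  obtain N where N: "N \<ge> 1" "\<And>(f :: 'a \<Rightarrow> 'a) x. (f ^^ N) ((f ^^ N) x) = (f ^^ N) x"
    using exists_idempotent_power by blast
  have pow: "(g ^^ n) ` U = U" for n
  proof (induction n)
    case (Suc n)
    have "(g ^^ Suc n) ` U = g ` ((g ^^ n) ` U)" by (simp add: image_comp)
    then show ?case using Suc gU by simp
  qed simp
  have "range (g ^^ N) \<subseteq> U"
  proof -
    obtain M where "N = Suc M" using N(1) by (cases N) auto
    moreover have "range g \<subseteq> U" using f(2) by (auto simp: g_def)
    ultimately show ?thesis by auto
  qed
  moreover have "U \<subseteq> range (g ^^ N)" using pow[of N] by blast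
  moreover have "(g ^^ N) x = x" if "x \<in> U" for x
  proof -
    from that pow[of N] obtain z where "x = (g ^^ N) z" by blast
    then show ?thesis using N(2) by simp
  qed
  ultimately show ?thesis using Pol1_funpow[OF g] by blast
qed

section \<open>Absence of snags makes the twin monoid a nilpotent group\<close>

lemma Fam_subst:
  assumes "F \<in> Fam A \<alpha>s" and "(\<lambda>i. snd (\<phi> i)) \<in> Clo A G"
    and "\<And>j x y. j < length \<alpha>s \<Longrightarrow> (x, y) \<in> \<alpha>s ! j \<Longrightarrow>
           (\<lambda>i. if fst (\<phi> i) j then y else x) \<in> Clo A G"
    and "const_maps \<subseteq> G"
  shows "(\<lambda>i. F (\<phi> i)) \<in> Clo A G"
proof (rule Clo_subst[OF assms(1)[unfolded Fam_def]])
  fix g :: "(nat \<Rightarrow> bool) \<times> _ \<Rightarrow> _" assume "g \<in> insert snd (edge_maps \<alpha>s fst)"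
  then consider "g = snd" | "g \<in> edge_maps \<alpha>s fst" by blast
  then show "(\<lambda>i. g (\<phi> i)) \<in> Clo A G"
  proof cases
    case 1
    then show ?thesis using assms(2) by simp
  next
    case 2
    then show ?thesis
    proof (cases rule: edge_mapsE)
      case (const c)
      then show ?thesis using assms(4) by (auto intro: Clo.gen)
    next
      case (edge j x y)
      then show ?thesis using assms(3) by simp
    qed
  qed
qed

lemma Fam_snd: "snd \<in> Fam A \<alpha>s"
  unfolding Fam_def by (rule Clo.gen) simp

lemma Fam_Pol1: "p \<in> Pol1 A \<Longrightarrow> F \<in> Fam A \<alpha>s \<Longrightarrow> (\<lambda>i. p (F i)) \<in> Fam A \<alpha>s"
  unfolding Fam_def by (rule Pol1_comp_Clo) (auto simp: edge_maps_def)

lemma Fam_comp: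
  assumes "F \<in> Fam A \<alpha>s" and "F' \<in> Fam A \<alpha>s"
  shows "(\<lambda>i. F (fst i, F' i)) \<in> Fam A \<alpha>s"
  unfolding Fam_def
proof (rule Fam_subst[OF assms(1)])
  show "(\<lambda>i. snd (fst i, F' i)) \<in> Clo A (insert snd (edge_maps \<alpha>s fst))"
    using assms(2) by (simp add: Fam_def)
next
  fix j x y assume "j < length \<alpha>s" "(x, y) \<in> \<alpha>s ! j"
  then show "(\<lambda>i. if fst (fst i, F' i) j then y else x) \<in> Clo A (insert snd (edge_maps \<alpha>s fst))"
    using edge_mapsI[of j \<alpha>s x y fst] by (auto intro!: Clo.gen)
qed (auto simp: edge_maps_def)

lemma Fam_funpow:
  assumes "F \<in> Fam A \<alpha>s"
  shows "(\<lambda>i. ((\<lambda>x. F (fst i, x)) ^^ n) (snd i)) \<in> Fam A \<alpha>s"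
proof (induction n)
  case 0
  then show ?case using Fam_snd by simp
next
  case (Suc n)
  then show ?case using Fam_comp[OF assms Suc] by simp
qed

lemma edge_maps_replicate_mono:
  assumes "n \<le> m"
  shows "edge_maps (replicate n \<beta>) \<pi> \<subseteq> edge_maps (replicate m \<beta>) \<pi>"
proof
  fix g assume "g \<in> edge_maps (replicate n \<beta>) \<pi>"
  then show "g \<in> edge_maps (replicate m \<beta>) \<pi>"
  proof (cases rule: edge_mapsE)
    case (edge j x y)
    then show ?thesis using edge_mapsI[of j "replicate m \<beta>" x y \<pi>] assms by simp
  qed simp
qed

lemma Fam_mono:
  assumes "F \<in> Fam A (replicate n \<beta>)" and "n \<le> m"
  shows "F \<in> Fam A (replicate m \<beta>)"
  using assms(1) unfolding Fam_def
  by (rule Clo_mono) (use edge_maps_replicate_mono[OF assms(2)] in blast)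

lemma Fam_reindex:
  assumes "F \<in> Fam A [\<beta>]" and "n < m"
  shows "(\<lambda>i. F (\<lambda>_. fst i n, snd i)) \<in> Fam A (replicate m \<beta>)"
  unfolding Fam_def
proof (rule Fam_subst[OF assms(1)])
  fix j x y assume "j < length [\<beta>]" "(x, y) \<in> [\<beta>] ! j"
  then show "(\<lambda>i. if fst (\<lambda>_. fst i n, snd i) j then y else x)
      \<in> Clo A (insert snd (edge_maps (replicate m \<beta>) fst))"
    using edge_mapsI[of n "replicate m \<beta>" x y fst] assms(2) by (auto intro!: Clo.gen)
qed (auto simp: edge_maps_def intro: Clo.gen)

lemma Fam_cong:
  assumes "F \<in> Fam A \<alpha>s" and "\<And>j. j < length \<alpha>s \<Longrightarrow> e j = e' j"
  shows "F (e, x) = F (e', x)"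
  using assms(1) unfolding Fam_def
  by (rule Clo_cong) (use assms(2) in \<open>auto elim!: edge_mapsE\<close>)

lemma Fam_to_Mat: "F \<in> Fam A \<alpha>s \<Longrightarrow> (\<lambda>e. F (e, x)) \<in> Mat A \<alpha>s"
  unfolding Mat_def
  by (rule Fam_subst) (auto intro!: Clo.gen edge_mapsI)

lemma snagsI:
  fixes A :: "('s, 'a::finite) ualgebra"
  assumes "m \<in> Mat A (replicate n \<beta>)" and "u \<noteq> v" and "e0 \<in> cube n" and "m ((!) e0) = v"
    and "\<And>e. e \<in> cube n \<Longrightarrow> e \<noteq> e0 \<Longrightarrow> m ((!) e) = u"
  shows "(u, v) \<in> snags A \<beta> n"
proof -
  let ?m = "\<lambda>e\<in>cube n. m ((!) e)"
  have "?m \<in> matrices A (replicate n \<beta>)"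
    using assms(1) unfolding matrices_eq_Mat by auto
  moreover have "?m e0 = v \<and> (\<forall>e\<in>cube n - {e0}. ?m e = u)"
    using assms(3-5) by simp
  ultimately show ?thesis
    using assms(2,3) unfolding snags_def by blast
qed

lemma twins_sym:
  assumes "twins A \<beta> f g" and "\<beta> \<in> Con A"
  shows "twins A \<beta> g f"
proof -
  obtain as bs h where h: "list_all2 (\<lambda>x y. (x, y) \<in> \<beta>) as bs" "h \<in> Pol A (Suc (length as))"
    "\<forall>x. f x = h (x # as)" "\<forall>x. g x = h (x # bs)" "f \<in> Pol1 A" "g \<in> Pol1 A"
    using assms(1) unfolding twins_def by blast
  have "list_all2 (\<lambda>x y. (x, y) \<in> \<beta>) bs as"
    using h(1) Con_sym[OF assms(2)] by (auto simp: list_all2_conv_all_nth)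
  moreover have "length bs = length as" using h(1) by (simp add: list_all2_lengthD)
  ultimately show ?thesis using h unfolding twins_def by metis
qed

text \<open>For \<open>n = 1\<close> this is the twin monoid. These sets play the role of the terms of the lower
  central series: taking commutators adds a dimension, and a nonidentity member yields an
  \<open>n\<close>-dimensional snag.\<close>

definition Tw_cube :: "('s, 'a) ualgebra \<Rightarrow> 'a rel \<Rightarrow> 'a set \<Rightarrow> nat \<Rightarrow> ('a \<Rightarrow> 'a) set" where
  "Tw_cube A \<beta> U n = {g \<in> extensional U. \<exists>F\<in>Fam A (replicate n \<beta>). (\<forall>i. F i \<in> U) \<and>
     (\<forall>e. (\<exists>j<n. \<not> e j) \<longrightarrow> (\<forall>x\<in>U. F (e, x) = x)) \<and>
     (\<forall>e. (\<forall>j<n. e j) \<longrightarrow> (\<forall>x\<in>U. F (e, x) = g x))}"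

lemma Tw_cubeE:
  assumes "g \<in> Tw_cube A \<beta> U n"
  obtains F where "g \<in> extensional U" "F \<in> Fam A (replicate n \<beta>)" "\<And>i. F i \<in> U"
    "\<And>e j x. j < n \<Longrightarrow> \<not> e j \<Longrightarrow> x \<in> U \<Longrightarrow> F (e, x) = x"
    "\<And>e x. (\<And>j. j < n \<Longrightarrow> e j) \<Longrightarrow> x \<in> U \<Longrightarrow> F (e, x) = g x"
proof -
  obtain F where F: "g \<in> extensional U" "F \<in> Fam A (replicate n \<beta>)" "\<forall>i. F i \<in> U"
    "\<forall>e. (\<exists>j<n. \<not> e j) \<longrightarrow> (\<forall>x\<in>U. F (e, x) = x)"
    "\<forall>e. (\<forall>j<n. e j) \<longrightarrow> (\<forall>x\<in>U. F (e, x) = g x)"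
    using assms unfolding Tw_cube_def by (elim CollectE conjE bexE)
  show thesis
  proof (rule that[OF F(1,2)])
    show "F (e, x) = x" if "j < n" "\<not> e j" "x \<in> U" for e j x
      using F(4) that by blast
    show "F i \<in> U" for i using F(3) by blast
    show "F (e, x) = g x" if "\<And>j. j < n \<Longrightarrow> e j" "x \<in> U" for e x
      using F(5) that by blast
  qed
qed

lemma Tw_cubeI:
  assumes "g \<in> extensional U" "F \<in> Fam A (replicate n \<beta>)" "\<And>i. F i \<in> U"
    "\<And>e j x. j < n \<Longrightarrow> \<not> e j \<Longrightarrow> x \<in> U \<Longrightarrow> F (e, x) = x"
    "\<And>e x. (\<And>j. j < n \<Longrightarrow> e j) \<Longrightarrow> x \<in> U \<Longrightarrow> F (e, x) = g x"
  shows "g \<in> Tw_cube A \<beta> U n"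
  unfolding Tw_cube_def
  using assms(1,3-5) by (intro CollectI conjI bexI[OF _ assms(2)] allI impI ballI) auto

lemma funpow_closed: "(\<And>x. x \<in> U \<Longrightarrow> f x \<in> U) \<Longrightarrow> x \<in> U \<Longrightarrow> (f ^^ n) x \<in> U"
  by (induction n) auto

lemma funpow_cong_on:
  assumes "\<And>x. x \<in> U \<Longrightarrow> f x = g x" "\<And>x. x \<in> U \<Longrightarrow> g x \<in> U" "x \<in> U"
  shows "(f ^^ n) x = (g ^^ n) x"
proof (induction n)
  case (Suc n)
  have "(g ^^ n) x \<in> U" using assms(2,3) by (rule funpow_closed)
  then show ?case using Suc assms(1) by simp
qed simp

lemma funpow_identity_on:
  assumes N: "\<And>x. (f ^^ N) ((f ^^ N) x) = (f ^^ N) x"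
    and "inj_on f U" and closed: "\<And>x. x \<in> U \<Longrightarrow> f x \<in> U" and "x \<in> U"
  shows "(f ^^ N) x = x"
proof -
  have "inj_on (f ^^ n) U" for n
  proof (induction n)
    case (Suc n)
    have "(f ^^ n) ` U \<subseteq> U" using funpow_closed[of U f] closed by blast
    then have "inj_on f ((f ^^ n) ` U)" using assms(2) inj_on_subset by blast
    with Suc show ?case unfolding funpow.simps by (rule comp_inj_on)
  qed (simp add: inj_on_def)
  moreover have "(f ^^ N) x \<in> U" using closed \<open>x \<in> U\<close> by (rule funpow_closed)
  ultimately show ?thesis using N[of x] \<open>x \<in> U\<close> by (metis inj_onD)
qed

lemma Bij_iff_inj:
  fixes U :: "'a::finite set"
  shows "g \<in> Bij U \<longleftrightarrow> g \<in> extensional U \<and> g ` U \<subseteq> U \<and> inj_on g U"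
  unfolding Bij_def bij_betw_def using endo_inj_surj[of U g] by auto

locale polynomial_retract =
  fixes A :: "('s, 'a::finite) ualgebra" and \<beta> :: "'a rel" and U :: "'a set" and r :: "'a \<Rightarrow> 'a"
  assumes \<beta>_Con: "\<beta> \<in> Con A" and r_Pol1: "r \<in> Pol1 A" and r_range: "range r = U"
    and r_fix: "\<And>x. x \<in> U \<Longrightarrow> r x = x"
begin

lemma r_in [simp]: "r x \<in> U"
  using r_range by blast

text \<open>Composing with \<open>r\<close> puts the whole family into \<open>U\<close> without
  changing its two ends on \<open>U\<close>. The twins are taken in reversed order, so that the
  identity sits at the false vertex.\<close>

lemma Tw_eq: "Tw A \<beta> U = Tw_cube A \<beta> U 1"
proof (intro equalityI subsetI)
  fix g assume "g \<in> Tw A \<beta> U"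
  then obtain f h where f: "g = restrict f U" "range f \<subseteq> U" "twins A \<beta> f h" "\<And>x. x \<in> U \<Longrightarrow> h x = x"
    unfolding Tw_def by blast
  obtain F where F: "F \<in> Fam A [\<beta>]" "h = (\<lambda>x. F (\<lambda>_. False, x))" "f = (\<lambda>x. F (\<lambda>_. True, x))"
    using twins_sym[OF f(3) \<beta>_Con] unfolding twins_iff_Fam by blast
  show "g \<in> Tw_cube A \<beta> U 1"
  proof (rule Tw_cubeI[where F = "\<lambda>i. r (F i)"])
    show "(\<lambda>i. r (F i)) \<in> Fam A (replicate 1 \<beta>)"
      using Fam_Pol1[OF r_Pol1 F(1)] by simp
  next
    fix e :: "nat \<Rightarrow> bool" and j x assume "j < 1" "\<not> e j" "x \<in> U"
    then have "F (e, x) = h x" unfolding F(2) by (intro Fam_cong[OF F(1)]) auto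
    then show "r (F (e, x)) = x" using f(4) \<open>x \<in> U\<close> r_fix by simp
  next
    fix e :: "nat \<Rightarrow> bool" and x assume "\<And>j. j < 1 \<Longrightarrow> e j" "x \<in> U"
    then have "F (e, x) = f x" unfolding F(3) by (intro Fam_cong[OF F(1)]) auto
    then show "r (F (e, x)) = g x" using f(1,2) \<open>x \<in> U\<close> r_fix by (simp add: range_subsetD)
  qed (use f(1) in simp_all)
next
  fix g assume "g \<in> Tw_cube A \<beta> U 1"
  then obtain F where g: "g \<in> extensional U" and F: "F \<in> Fam A (replicate 1 \<beta>)" "\<And>i. F i \<in> U"
    "\<And>e j x. j < 1 \<Longrightarrow> \<not> e j \<Longrightarrow> x \<in> U \<Longrightarrow> F (e, x) = x"
    "\<And>e x. (\<And>j. j < 1 \<Longrightarrow> e j) \<Longrightarrow> x \<in> U \<Longrightarrow> F (e, x) = g x"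
    by (rule Tw_cubeE) blast
  let ?f = "\<lambda>x. F (\<lambda>_. True, x)" and ?h = "\<lambda>x. F (\<lambda>_. False, x)"
  have "twins A \<beta> ?h ?f"
    unfolding twins_iff_Fam using F(1) by auto
  then have tw: "twins A \<beta> ?f ?h" by (rule twins_sym[OF _ \<beta>_Con])
  then have "?f \<in> Pol1 A" "?h \<in> Pol1 A" unfolding twins_def by auto
  moreover have "g = restrict ?f U"
    using g F(4) by (intro extensionalityI[of _ U]) auto
  moreover have "range ?f \<subseteq> U" "\<forall>x\<in>U. ?h x = x" using F(2,3) by auto
  ultimately show "g \<in> Tw A \<beta> U" using tw unfolding Tw_def by blast
qed

lemma Tw_cube_closed:
  assumes "g \<in> Tw_cube A \<beta> U n" and "x \<in> U"
  shows "g x \<in> U"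
proof -
  obtain F where F: "\<And>i. F i \<in> U" "\<And>e x. (\<And>j. j < n \<Longrightarrow> e j) \<Longrightarrow> x \<in> U \<Longrightarrow> F (e, x) = g x"
    using assms(1) by (rule Tw_cubeE) blast
  have "F (\<lambda>_. True, x) = g x" using assms(2) by (intro F(2)) simp_all
  then show ?thesis using F(1) by metis
qed

text \<open>Identifying all directions restricts the cube to its main diagonal; as \<open>n\<close>
  is positive, the bottom of the diagonal carries the identity.\<close>

lemma Tw_cube_subset:
  assumes "n \<ge> 1"
  shows "Tw_cube A \<beta> U n \<subseteq> Tw_cube A \<beta> U 1"
proof
  fix g assume "g \<in> Tw_cube A \<beta> U n"
  then obtain F where g: "g \<in> extensional U" and F: "F \<in> Fam A (replicate n \<beta>)" "\<And>i. F i \<in> U"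
    "\<And>e j x. j < n \<Longrightarrow> \<not> e j \<Longrightarrow> x \<in> U \<Longrightarrow> F (e, x) = x"
    "\<And>e x. (\<And>j. j < n \<Longrightarrow> e j) \<Longrightarrow> x \<in> U \<Longrightarrow> F (e, x) = g x"
    by (rule Tw_cubeE) blast
  have "(\<lambda>i. F (\<lambda>_. fst i 0, snd i)) \<in> Fam A [\<beta>]"
    unfolding Fam_def
  proof (rule Fam_subst[OF F(1)])
    fix j x y assume "j < length (replicate n \<beta>)" "(x, y) \<in> replicate n \<beta> ! j"
    then show "(\<lambda>i. if fst (\<lambda>_. fst i 0, snd i) j then y else x)
        \<in> Clo A (insert snd (edge_maps [\<beta>] fst))"
      using edge_mapsI[of 0 "[\<beta>]" x y fst] by (auto intro!: Clo.gen)
  qed (auto simp: edge_maps_def intro: Clo.gen)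
  moreover have "F (\<lambda>_. e 0, x) = x" if "\<not> e 0" "x \<in> U" for e :: "nat \<Rightarrow> bool" and x
    using that assms by (intro F(3)[of 0]) auto
  ultimately show "g \<in> Tw_cube A \<beta> U 1"
    using g F(2,4) by (intro Tw_cubeI[where F = "\<lambda>i. F (\<lambda>_. fst i 0, snd i)"]) auto
qed

lemma Tw_cube_one: "(\<lambda>x\<in>U. x) \<in> Tw_cube A \<beta> U n"
  by (rule Tw_cubeI[where F = "\<lambda>i. r (snd i)"])
    (auto simp: r_fix intro!: Fam_Pol1[OF r_Pol1] Fam_snd)

lemma Tw_cube_mult:
  assumes "f \<in> Tw_cube A \<beta> U n" and "g \<in> Tw_cube A \<beta> U n"
  shows "compose U f g \<in> Tw_cube A \<beta> U n"
proof -
  obtain F where F: "F \<in> Fam A (replicate n \<beta>)" "\<And>i. F i \<in> U"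
    "\<And>e j x. j < n \<Longrightarrow> \<not> e j \<Longrightarrow> x \<in> U \<Longrightarrow> F (e, x) = x"
    "\<And>e x. (\<And>j. j < n \<Longrightarrow> e j) \<Longrightarrow> x \<in> U \<Longrightarrow> F (e, x) = f x"
    using assms(1) by (rule Tw_cubeE) blast
  obtain H where H: "H \<in> Fam A (replicate n \<beta>)" "\<And>i. H i \<in> U"
    "\<And>e j x. j < n \<Longrightarrow> \<not> e j \<Longrightarrow> x \<in> U \<Longrightarrow> H (e, x) = x"
    "\<And>e x. (\<And>j. j < n \<Longrightarrow> e j) \<Longrightarrow> x \<in> U \<Longrightarrow> H (e, x) = g x"
    using assms(2) by (rule Tw_cubeE) blast
  show ?thesis
  proof (rule Tw_cubeI[OF _ Fam_comp[OF F(1) H(1)]])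
    fix e :: "nat \<Rightarrow> bool" and x assume e: "\<And>j. j < n \<Longrightarrow> e j" and x: "x \<in> U"
    have "H (e, x) = g x" using H(4)[of e x] e x by blast
    moreover have "F (e, g x) = f (g x)"
      using F(4)[of e "g x"] e Tw_cube_closed[OF assms(2) x] by blast
    ultimately show "F (fst (e, x), H (e, x)) = compose U f g x" by (simp add: compose_def x)
  qed (use F(2,3) H(2,3) in \<open>auto simp: compose_def\<close>)
qed

lemma Tw_cube_funpow:
  assumes "f \<in> Tw_cube A \<beta> U n"
  shows "restrict (f ^^ m) U \<in> Tw_cube A \<beta> U n"
proof (induction m)
  case 0
  then show ?case using Tw_cube_one by (simp add: restrict_def)
next
  case (Suc m)
  have "restrict (f ^^ Suc m) U = compose U f (restrict (f ^^ m) U)"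
    by (auto simp: compose_def)
  then show ?case using Tw_cube_mult[OF assms Suc] by (simp only:)
qed

text \<open>Some power \<open>q\<close> of a twin is idempotent; if \<open>y = q x \<noteq> x\<close>, the twin family of \<open>q\<close> restricted to
  \<open>{x, y}\<close> is a join with \<open>x\<close> as least element, so joins of edges from \<open>x\<close> to \<open>y\<close> are snags.\<close>

lemma Tw_cube_1_Bij:
  assumes snags: "snags A \<beta> (Suc k) = {}"
  shows "Tw_cube A \<beta> U 1 \<subseteq> Bij U"
proof
  fix g assume g: "g \<in> Tw_cube A \<beta> U 1"
  then obtain F where ext: "g \<in> extensional U" and F: "F \<in> Fam A (replicate 1 \<beta>)" "\<And>i. F i \<in> U"
    "\<And>e j x. j < 1 \<Longrightarrow> \<not> e j \<Longrightarrow> x \<in> U \<Longrightarrow> F (e, x) = x"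
    "\<And>e x. (\<And>j. j < 1 \<Longrightarrow> e j) \<Longrightarrow> x \<in> U \<Longrightarrow> F (e, x) = g x"
    by (rule Tw_cubeE) blast
  obtain N where N: "N \<ge> 1" "\<And>(f :: 'a \<Rightarrow> 'a) x. (f ^^ N) ((f ^^ N) x) = (f ^^ N) x"
    using exists_idempotent_power by blast
  have gU: "g x \<in> U" if "x \<in> U" for x using Tw_cube_closed[OF g that] .
  have fixpt: "(g ^^ N) x = x" if x: "x \<in> U" for x
  proof (rule ccontr)
    define y where "y = (g ^^ N) x"
    assume "(g ^^ N) x \<noteq> x"
    then have yx: "y \<noteq> x" by (simp add: y_def)
    have y: "y \<in> U" "(g ^^ N) y = y"
      using x gU N(2) by (simp_all add: y_def funpow_closed)
    define H where "H = (\<lambda>i. ((\<lambda>x. F (fst i, x)) ^^ N) (snd i))"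
    have H: "H \<in> Fam A (replicate 1 \<beta>)" unfolding H_def by (rule Fam_funpow[OF F(1)])
    have HF: "H (e, z) = z" if "\<not> e 0" "z \<in> U" for e z
    proof -
      have "((\<lambda>x. F (e, x)) ^^ N) z = ((\<lambda>x. x) ^^ N) z"
        by (rule funpow_cong_on[of U]) (use F(3)[of 0 e] that in auto)
      then show ?thesis by (simp add: H_def id_def[symmetric])
    qed
    have HT: "H (e, z) = (g ^^ N) z" if "e 0" "z \<in> U" for e z
      unfolding H_def fst_conv snd_conv
      by (rule funpow_cong_on[of U]) (use F(4)[of e] that gU in auto)
    \<comment> \<open>\<open>x\<close> and \<open>y\<close> are the values at \<open>x\<close> of
      the two ends of the family, whose parameters are \<beta>-related.\<close>
    have xy: "(x, y) \<in> \<beta>"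
    proof -
      have "(H (\<lambda>_. False, x), H (\<lambda>_. True, x)) \<in> \<beta>"
        using H unfolding Fam_def
        by (rule Clo_Con[OF _ \<beta>_Con]) (auto elim!: edge_mapsE intro: Con_refl[OF \<beta>_Con])
      then show ?thesis using HF[of "\<lambda>_. False" x] HT[of "\<lambda>_. True" x] x by (simp add: y_def)
    qed
    \<comment> \<open>Each new direction applies \<open>H\<close>: when it is on, both
      \<open>x\<close> and \<open>y\<close> go to \<open>y\<close>; when it is off, both stay
      fixed.\<close>
    have "\<exists>m\<in>Mat A (replicate (Suc n) \<beta>). \<forall>e. m e = (if \<exists>i\<le>n. e i then y else x)" for n
    proof (induction n)
      case 0
      show ?case
        using edge_mapsI[of 0 "[\<beta>]" x y "\<lambda>e. e"] xy
        by (auto simp: Mat_def intro!: bexI[of _ "\<lambda>e. if e 0 then y else x"] Clo.gen)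
    next
      case (Suc n)
      then obtain m where m: "m \<in> Mat A (replicate (Suc n) \<beta>)"
        "\<And>e. m e = (if \<exists>i\<le>n. e i then y else x)" by blast
      define m' where "m' = (\<lambda>e. H (\<lambda>_. e (Suc n), m e))"
      have "m' \<in> Mat A (replicate (Suc (Suc n)) \<beta>)"
        unfolding Mat_def m'_def
      proof (rule Fam_subst[OF H])
        have "edge_maps (replicate (Suc n) \<beta>) (\<lambda>e. e) \<subseteq> edge_maps (replicate (Suc (Suc n)) \<beta>) (\<lambda>e. e)"
          by (rule edge_maps_replicate_mono) simp
        then show "(\<lambda>e. snd (\<lambda>_. e (Suc n), m e)) \<in> Clo A (edge_maps (replicate (Suc (Suc n)) \<beta>) (\<lambda>e. e))"
          using m(1) unfolding Mat_def snd_conv by (auto intro: Clo_mono)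
      next
        fix j a b assume "j < length (replicate 1 \<beta>)" "(a, b) \<in> replicate 1 \<beta> ! j"
        then show "(\<lambda>e. if fst (\<lambda>_. e (Suc n), m e) j then b else a)
            \<in> Clo A (edge_maps (replicate (Suc (Suc n)) \<beta>) (\<lambda>e. e))"
          using edge_mapsI[of "Suc n" "replicate (Suc (Suc n)) \<beta>" a b "\<lambda>e. e"]
          by (auto intro!: Clo.gen simp del: replicate_Suc)
      qed simp
      moreover have "m' e = (if \<exists>i\<le>Suc n. e i then y else x)" for e
      proof (cases "e (Suc n)")
        case True
        then show ?thesis
          unfolding m'_def m(2) using HT[of "\<lambda>_. True"] x y by (auto simp: y_def[symmetric])
      next
        case False
        then show ?thesis
          unfolding m'_def m(2) using HF[of "\<lambda>_. False"] x y by (auto simp: le_Suc_eq)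
      qed
      ultimately show ?case by blast
    qed
    then obtain m where m: "m \<in> Mat A (replicate (Suc k) \<beta>)"
      "\<And>e. m e = (if \<exists>i\<le>k. e i then y else x)" by blast
    have "(y, x) \<in> snags A \<beta> (Suc k)"
    proof (rule snagsI[OF m(1) yx])
      show "replicate (Suc k) False \<in> cube (Suc k)" by (simp add: cube_def)
      show "m ((!) (replicate (Suc k) False)) = x"
        by (auto simp: m(2) less_Suc_eq_le simp del: replicate_Suc)
      fix e assume "e \<in> cube (Suc k)" "e \<noteq> replicate (Suc k) False"
      then have "\<exists>i\<le>k. e ! i"
        by (auto simp: cube_def list_eq_iff_nth_eq less_Suc_eq_le simp del: replicate_Suc)
      then show "m ((!) e) = y" by (simp add: m(2))
    qed
    then show False using snags by simp
  qed
  obtain M where "N = Suc M" using N(1) by (cases N) auto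
  then have "inj_on g U"
    using fixpt by (intro inj_on_inverseI[where g = "g ^^ M"]) (simp add: funpow_swap1)
  then show "g \<in> Bij U"
    using ext gU unfolding Bij_iff_inj by blast
qed

end

section \<open>The twin group and its lower central series\<close>

lemma BijGroup_simps:
  assumes "T \<subseteq> Bij U" and "f \<in> T" and "g \<in> T"
  shows "f \<otimes>\<^bsub>BijGroup U\<lparr>carrier := T\<rparr>\<^esub> g = compose U f g"
  using assms by (auto simp: BijGroup_def)

context polynomial_retract
begin

abbreviation TwG :: "('a \<Rightarrow> 'a) monoid" where
  "TwG \<equiv> BijGroup U\<lparr>carrier := Tw_cube A \<beta> U 1\<rparr>"

lemma TwG_one: "\<one>\<^bsub>TwG\<^esub> = (\<lambda>x\<in>U. x)"
  by (simp add: BijGroup_def)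

lemma Tw_inverse:
  assumes N: "N \<ge> 1" "\<And>(f :: 'a \<Rightarrow> 'a) x. (f ^^ N) ((f ^^ N) x) = (f ^^ N) x"
    and "f \<in> Bij U"
  shows "compose U (restrict (f ^^ (N - 1)) U) f = (\<lambda>x\<in>U. x)"
proof
  fix x
  have f: "inj_on f U" "\<And>x. x \<in> U \<Longrightarrow> f x \<in> U"
    using assms(3) unfolding Bij_iff_inj by auto
  obtain M where "N = Suc M" using N(1) by (cases N) auto
  then show "compose U (restrict (f ^^ (N - 1)) U) f x = (\<lambda>x\<in>U. x) x"
    using funpow_identity_on[OF N(2) f] f(2) by (simp add: compose_def funpow_swap1)
qed

text \<open>The inverse of a member is one of its powers, and these stay in the twin monoid.\<close>

lemma Tw_subgroup:
  assumes "Tw_cube A \<beta> U 1 \<subseteq> Bij U"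
  shows "subgroup (Tw_cube A \<beta> U 1) (BijGroup U)"
proof (rule group.subgroupI[OF group_BijGroup])
  show "Tw_cube A \<beta> U 1 \<subseteq> carrier (BijGroup U)" using assms by (simp add: BijGroup_def)
  show "Tw_cube A \<beta> U 1 \<noteq> {}" using Tw_cube_one by blast
next
  fix f g assume "f \<in> Tw_cube A \<beta> U 1" "g \<in> Tw_cube A \<beta> U 1"
  then show "f \<otimes>\<^bsub>BijGroup U\<^esub> g \<in> Tw_cube A \<beta> U 1"
    using assms Tw_cube_mult by (auto simp: BijGroup_def)
next
  fix f assume f: "f \<in> Tw_cube A \<beta> U 1"
  obtain N where N: "N \<ge> 1" "\<And>(f :: 'a \<Rightarrow> 'a) x. (f ^^ N) ((f ^^ N) x) = (f ^^ N) x"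
    using exists_idempotent_power by blast
  have "restrict (f ^^ (N - 1)) U \<in> Tw_cube A \<beta> U 1"
    using Tw_cube_funpow[OF f] .
  moreover have "inv\<^bsub>BijGroup U\<^esub> f = restrict (f ^^ (N - 1)) U"
    using calculation f assms Tw_inverse[OF N, of f]
    by (intro group.inv_equality[OF group_BijGroup]) (auto simp: BijGroup_def)
  ultimately show "inv\<^bsub>BijGroup U\<^esub> f \<in> Tw_cube A \<beta> U 1" by simp
qed

lemma TwG_group:
  assumes "Tw_cube A \<beta> U 1 \<subseteq> Bij U"
  shows "group TwG"
  using subgroup.subgroup_is_group[OF Tw_subgroup[OF assms] group_BijGroup] .

lemma TwG_inv:
  assumes T: "Tw_cube A \<beta> U 1 \<subseteq> Bij U" and f: "f \<in> Tw_cube A \<beta> U 1"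
    and N: "N \<ge> 1" "\<And>(f :: 'a \<Rightarrow> 'a) x. (f ^^ N) ((f ^^ N) x) = (f ^^ N) x"
  shows "inv\<^bsub>TwG\<^esub> f = restrict (f ^^ (N - 1)) U"
proof (rule group.inv_equality[OF TwG_group[OF T]])
  show 1: "restrict (f ^^ (N - 1)) U \<in> carrier TwG" "f \<in> carrier TwG"
    using Tw_cube_funpow[OF f] f by auto
  show "restrict (f ^^ (N - 1)) U \<otimes>\<^bsub>TwG\<^esub> f = \<one>\<^bsub>TwG\<^esub>"
    using 1 Tw_inverse[OF N, of f] T f
    by (subst BijGroup_simps[OF T]) (auto simp: BijGroup_def)
qed

text \<open>The cube of \<open>f\<close> occupies the first \<open>n\<close> directions and that of
  \<open>g\<close> direction \<open>n\<close>. At a vertex where one of them is off, its factor and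
  the inverse of that factor become the identity and the rest cancels.\<close>

lemma Tw_cube_commutator:
  assumes T: "Tw_cube A \<beta> U 1 \<subseteq> Bij U" and n: "n \<ge> 1"
    and f: "f \<in> Tw_cube A \<beta> U n" and g: "g \<in> Tw_cube A \<beta> U 1"
  shows "f \<otimes>\<^bsub>TwG\<^esub> g \<otimes>\<^bsub>TwG\<^esub> inv\<^bsub>TwG\<^esub> f \<otimes>\<^bsub>TwG\<^esub> inv\<^bsub>TwG\<^esub> g \<in> Tw_cube A \<beta> U (Suc n)"
proof -
  interpret G: group TwG using TwG_group[OF T] .
  obtain N where N: "N \<ge> 1" "\<And>(f :: 'a \<Rightarrow> 'a) x. (f ^^ N) ((f ^^ N) x) = (f ^^ N) x"
    using exists_idempotent_power by blast
  obtain M where M: "N = Suc M" using N(1) by (cases N) auto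
  have f1: "f \<in> Tw_cube A \<beta> U 1" using Tw_cube_subset[OF n] f by blast
  have "f \<in> Bij U" "g \<in> Bij U" using f1 g T by blast+
  then have inj: "inj_on f U" "inj_on g U" unfolding Bij_iff_inj by simp_all
  have fU: "f x \<in> U" and gU: "g x \<in> U" if "x \<in> U" for x
    using Tw_cube_closed[OF f that] Tw_cube_closed[OF g that] by simp_all
  obtain F where F: "F \<in> Fam A (replicate n \<beta>)" "\<And>i. F i \<in> U"
    "\<And>e j x. j < n \<Longrightarrow> \<not> e j \<Longrightarrow> x \<in> U \<Longrightarrow> F (e, x) = x"
    "\<And>e x. (\<And>j. j < n \<Longrightarrow> e j) \<Longrightarrow> x \<in> U \<Longrightarrow> F (e, x) = f x"
    using f by (rule Tw_cubeE) blast
  obtain H0 where H0: "H0 \<in> Fam A (replicate 1 \<beta>)" "\<And>i. H0 i \<in> U"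
    "\<And>e j x. j < 1 \<Longrightarrow> \<not> e j \<Longrightarrow> x \<in> U \<Longrightarrow> H0 (e, x) = x"
    "\<And>e x. (\<And>j. j < 1 \<Longrightarrow> e j) \<Longrightarrow> x \<in> U \<Longrightarrow> H0 (e, x) = g x"
    using g by (rule Tw_cubeE) blast
  define H where "H = (\<lambda>i. H0 (\<lambda>_. fst i n, snd i))"
  \<comment> \<open>On \<open>U\<close> the inverses of \<open>f\<close> and \<open>g\<close> are
    their \<open>M\<close>-th powers, and iterating a family at each vertex gives a family
    again.\<close>
  define Fi where "Fi = (\<lambda>i. ((\<lambda>x. F (fst i, x)) ^^ M) (snd i))"
  define Hi where "Hi = (\<lambda>i. ((\<lambda>x. H (fst i, x)) ^^ M) (snd i))"
  define K where "K = (\<lambda>i. F (fst i, H (fst i, Fi (fst i, Hi i))))"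
  have Fam: "F \<in> Fam A (replicate (Suc n) \<beta>)" "H \<in> Fam A (replicate (Suc n) \<beta>)"
    using Fam_mono[OF F(1), of "Suc n"] Fam_reindex[of H0 A \<beta> n "Suc n"] H0(1) by (auto simp: H_def)
  then have "Fi \<in> Fam A (replicate (Suc n) \<beta>)" "Hi \<in> Fam A (replicate (Suc n) \<beta>)"
    unfolding Fi_def Hi_def by (simp_all only: Fam_funpow)
  then have K: "K \<in> Fam A (replicate (Suc n) \<beta>)"
    using Fam_comp[OF Fam(1) Fam_comp[OF Fam(2) Fam_comp[of Fi A _ Hi]]] unfolding K_def by simp
  have HF: "H (e, x) = x" if "\<not> e n" "x \<in> U" for e x
    using that H0(3)[of 0 "\<lambda>_. e n" x] by (simp add: H_def)
  have HT: "H (e, x) = g x" if "e n" "x \<in> U" for e x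
    using that H0(4)[of "\<lambda>_. e n" x] by (simp add: H_def)
  have HU: "H i \<in> U" for i unfolding H_def by (rule H0(2))
  have FiT: "Fi (e, x) = (f ^^ M) x" if "\<And>j. j < n \<Longrightarrow> e j" "x \<in> U" for e x
    unfolding Fi_def fst_conv snd_conv
    by (rule funpow_cong_on[of U]) (use F(4)[of e] that fU in auto)
  have HiT: "Hi (e, x) = (g ^^ M) x" if "e n" "x \<in> U" for e x
    unfolding Hi_def fst_conv snd_conv
    by (rule funpow_cong_on[of U]) (use HT[of e] that gU in auto)
  have id_pow: "((\<lambda>x. x) ^^ M) x = x" for x :: 'a
    by (induction M) auto
  have FiF: "Fi (e, x) = x" if "j < n" "\<not> e j" "x \<in> U" for e x j
    unfolding Fi_def fst_conv snd_conv
    by (subst funpow_cong_on[of U _ "\<lambda>x. x"]) (use F(3)[of j e] that id_pow in auto)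
  have HiF: "Hi (e, x) = x" if "\<not> e n" "x \<in> U" for e x
    unfolding Hi_def fst_conv snd_conv
    by (subst funpow_cong_on[of U _ "\<lambda>x. x"]) (use HF[of e] that id_pow in auto)
  have fM: "(f ^^ M) x \<in> U" "f ((f ^^ M) x) = x" and gM: "(g ^^ M) x \<in> U" "g ((g ^^ M) x) = x"
    if "x \<in> U" for x
    using that funpow_closed[OF fU] funpow_closed[OF gU] M
      funpow_identity_on[OF N(2) inj(1) fU that] funpow_identity_on[OF N(2) inj(2) gU that] by auto
  define c where "c = restrict (\<lambda>x. f (g ((f ^^ M) ((g ^^ M) x)))) U"
  have "c \<in> Tw_cube A \<beta> U (Suc n)"
  proof (rule Tw_cubeI[OF _ K])
    show "c \<in> extensional U" by (simp add: c_def)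
    show "K i \<in> U" for i unfolding K_def by (rule F(2))
  next
    fix e :: "nat \<Rightarrow> bool" and j x assume j: "j < Suc n" "\<not> e j" and x: "x \<in> U"
    show "K (e, x) = x"
    proof (cases "j < n")
      case True
      note low = F(3)[of j e, OF True j(2)] FiF[of j e, OF True j(2)]
      show ?thesis
      proof (cases "e n")
        case True
        then show ?thesis using x gM[OF x] by (simp add: K_def low HiT HT)
      next
        case False
        then show ?thesis using x by (simp add: K_def low HiF HF)
      qed
    next
      case False
      then have en: "\<not> e n" using j by (metis less_antisym)
      show ?thesis
      proof (cases "\<forall>i<n. e i")
        case True
        then show ?thesis using x fM[OF x] en by (simp add: K_def HiF HF FiT F(4))
      next
        case False
        then obtain i where i: "i < n" "\<not> e i" by blast
        show ?thesis using x en by (simp add: K_def HiF HF FiF[of i e, OF i] F(3)[of i e, OF i])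
      qed
    qed
  next
    fix e :: "nat \<Rightarrow> bool" and x assume e: "\<And>j. j < Suc n \<Longrightarrow> e j" and x: "x \<in> U"
    have fgx: "(f ^^ M) ((g ^^ M) x) \<in> U" using fM(1)[OF gM(1)[OF x]] .
    then show "K (e, x) = c x"
      using x e gM(1)[OF x] gU[OF fgx] by (simp add: K_def c_def HiT HT FiT F(4))
  qed
  moreover have "f \<otimes>\<^bsub>TwG\<^esub> g \<otimes>\<^bsub>TwG\<^esub> inv\<^bsub>TwG\<^esub> f \<otimes>\<^bsub>TwG\<^esub> inv\<^bsub>TwG\<^esub> g = c"
  proof -
    have "restrict (f ^^ M) U \<in> Tw_cube A \<beta> U 1" "restrict (g ^^ M) U \<in> Tw_cube A \<beta> U 1"
      using Tw_cube_funpow f1 g by auto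
    then have "f \<otimes>\<^bsub>TwG\<^esub> g \<otimes>\<^bsub>TwG\<^esub> restrict (f ^^ M) U \<otimes>\<^bsub>TwG\<^esub> restrict (g ^^ M) U =
        compose U (compose U (compose U f g) (restrict (f ^^ M) U)) (restrict (g ^^ M) U)"
      using f1 g by (simp only: BijGroup_simps[OF T] Tw_cube_mult)
    also have "\<dots> = c"
      using fM(1) gM(1) by (auto simp: compose_def c_def)
    finally show ?thesis
      using TwG_inv[OF T _ N] f1 g M by simp
  qed
  ultimately show ?thesis by simp
qed

text \<open>Commutators with the whole group raise the dimension by one, while each dimension is
  closed under products and powers. Index 0 is the whole group, hence the shift to
  \<open>Suc n\<close>.\<close>

lemma lower_central_subset_Tw_cube:
  assumes T: "Tw_cube A \<beta> U 1 \<subseteq> Bij U"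
  shows "lower_central TwG n \<subseteq> Tw_cube A \<beta> U (Suc n)"
proof (induction n)
  case 0
  show ?case by simp
next
  case (Suc n)
  obtain N where N: "N \<ge> 1" "\<And>(f :: 'a \<Rightarrow> 'a) x. (f ^^ N) ((f ^^ N) x) = (f ^^ N) x"
    using exists_idempotent_power by blast
  have sub: "Tw_cube A \<beta> U (Suc (Suc n)) \<subseteq> Tw_cube A \<beta> U 1" by (rule Tw_cube_subset) simp
  let ?C = "\<Union>x\<in>lower_central TwG n. \<Union>y\<in>carrier TwG.
      {x \<otimes>\<^bsub>TwG\<^esub> y \<otimes>\<^bsub>TwG\<^esub> inv\<^bsub>TwG\<^esub> x \<otimes>\<^bsub>TwG\<^esub> inv\<^bsub>TwG\<^esub> y}"
  have C: "?C \<subseteq> Tw_cube A \<beta> U (Suc (Suc n))"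
    using Suc Tw_cube_commutator[OF T, of "Suc n"] by auto
  show ?case
  proof
    fix x assume "x \<in> lower_central TwG (Suc n)"
    then have "x \<in> generate TwG ?C" by simp
    then show "x \<in> Tw_cube A \<beta> U (Suc (Suc n))"
    proof induction
      case one
      show ?case unfolding TwG_one by (rule Tw_cube_one)
    next
      case (incl h)
      then show ?case using C by blast
    next
      case (inv h)
      then have h: "h \<in> Tw_cube A \<beta> U (Suc (Suc n))" using C by blast
      then have "inv\<^bsub>TwG\<^esub> h = restrict (h ^^ (N - 1)) U"
        using sub by (intro TwG_inv[OF T _ N]) blast
      then show ?case using Tw_cube_funpow[OF h] by (simp only:)
    next
      case (eng h1 h2)
      then have "h1 \<otimes>\<^bsub>TwG\<^esub> h2 = compose U h1 h2"
        using sub by (intro BijGroup_simps[OF T]) auto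
      then show ?case using eng Tw_cube_mult by (simp only:)
    qed
  qed
qed

text \<open>If such a map moved \<open>x\<close>, its cube evaluated at \<open>x\<close> would be a
  snag with \<open>g x\<close> at the top vertex.\<close>

lemma Tw_cube_trivial:
  assumes "snags A \<beta> n = {}"
  shows "Tw_cube A \<beta> U n \<subseteq> {\<lambda>x\<in>U. x}"
proof
  fix g assume "g \<in> Tw_cube A \<beta> U n"
  then obtain F where ext: "g \<in> extensional U" and F: "F \<in> Fam A (replicate n \<beta>)" "\<And>i. F i \<in> U"
    "\<And>e j x. j < n \<Longrightarrow> \<not> e j \<Longrightarrow> x \<in> U \<Longrightarrow> F (e, x) = x"
    "\<And>e x. (\<And>j. j < n \<Longrightarrow> e j) \<Longrightarrow> x \<in> U \<Longrightarrow> F (e, x) = g x"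
    by (rule Tw_cubeE) blast
  have "g x = x" if x: "x \<in> U" for x
  proof (rule ccontr)
    assume "g x \<noteq> x"
    have "(x, g x) \<in> snags A \<beta> n"
    proof (rule snagsI[OF Fam_to_Mat[OF F(1)]])
      show "replicate n True \<in> cube n" by (simp add: cube_def)
      show "F ((!) (replicate n True), x) = g x" using x by (intro F(4)) auto
      fix e assume "e \<in> cube n" "e \<noteq> replicate n True"
      then obtain j where "j < n" "\<not> e ! j" by (auto simp: cube_def list_eq_iff_nth_eq)
      then show "F ((!) e, x) = x" using x by (rule F(3))
    qed (use \<open>g x \<noteq> x\<close> in auto)
    then show False using assms by simp
  qed
  then have "g = (\<lambda>x\<in>U. x)" using ext by (intro extensionalityI[of _ U]) auto
  then show "g \<in> {\<lambda>x\<in>U. x}" by simp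
qed

lemma no_snags_acts_as_nilpotent_group:
  assumes "snags A \<beta> (k + 1) = {}"
  shows "acts_as_nilpotent_group (Tw A \<beta> U) U k"
proof -
  have T: "Tw_cube A \<beta> U 1 \<subseteq> Bij U" using Tw_cube_1_Bij[of k] assms by simp
  interpret G: group TwG using TwG_group[OF T] .
  have "\<one>\<^bsub>TwG\<^esub> \<in> lower_central TwG k"
    by (cases k) (simp_all only: lower_central.simps G.one_closed generate.one)
  moreover have "lower_central TwG k \<subseteq> {\<one>\<^bsub>TwG\<^esub>}"
    using lower_central_subset_Tw_cube[OF T, of k] Tw_cube_trivial[of "Suc k"] assms
    by (auto simp: BijGroup_def)
  ultimately show ?thesis
    using T G.group_axioms unfolding acts_as_nilpotent_group_def nilpotent_group_class_le_def Tw_eq by blast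
qed

end

section \<open>Nilpotent twin groups force centrality\<close>

lemma lower_central_subgroup:
  assumes "group G"
  shows "subgroup (lower_central G i) G"
proof (induction i)
  case 0
  then show ?case using group.subgroup_self[OF assms] by simp
next
  case (Suc i)
  interpret group G by fact
  have "lower_central G i \<subseteq> carrier G" using Suc by (rule subgroup.subset)
  then show ?case
    unfolding lower_central.simps by (intro generate_is_subgroup) auto
qed

text \<open>Endomorphisms send commutators to commutators, so the series is fully invariant. This is
  applied to conjugation by polynomial permutations, which need not be inner.\<close>

lemma lower_central_hom:
  assumes "group G" and c: "c \<in> hom G G" and "x \<in> lower_central G i"
  shows "c x \<in> lower_central G i"
  using assms(3)
proof (induction i arbitrary: x)
  case 0
  then show ?case using hom_in_carrier[OF c] by simp
next
  case (Suc i)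
  interpret group_hom G G c using assms(1) c by (simp add: group_hom_def group_hom_axioms_def)
  let ?C = "\<Union>x\<in>lower_central G i. \<Union>y\<in>carrier G.
      {x \<otimes>\<^bsub>G\<^esub> y \<otimes>\<^bsub>G\<^esub> inv\<^bsub>G\<^esub> x \<otimes>\<^bsub>G\<^esub> inv\<^bsub>G\<^esub> y}"
  have lc: "lower_central G i \<subseteq> carrier G"
    using lower_central_subgroup[OF assms(1)] by (rule subgroup.subset)
  then have C: "?C \<subseteq> carrier G" by auto
  have "c ` ?C \<subseteq> ?C"
  proof
    fix z assume "z \<in> c ` ?C"
    then obtain x y where xy: "x \<in> lower_central G i" "y \<in> carrier G"
      and z: "z = c (x \<otimes>\<^bsub>G\<^esub> y \<otimes>\<^bsub>G\<^esub> inv\<^bsub>G\<^esub> x \<otimes>\<^bsub>G\<^esub> inv\<^bsub>G\<^esub> y)" by auto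
    have "x \<in> carrier G" using xy lc by blast
    then have "z = c x \<otimes>\<^bsub>G\<^esub> c y \<otimes>\<^bsub>G\<^esub> inv\<^bsub>G\<^esub> c x \<otimes>\<^bsub>G\<^esub> inv\<^bsub>G\<^esub> c y"
      using xy(2) unfolding z by simp
    moreover have "c x \<in> lower_central G i" "c y \<in> carrier G" using Suc.IH xy by auto
    ultimately show "z \<in> ?C" by blast
  qed
  then have "generate G (c ` ?C) \<subseteq> generate G ?C" by (rule G.mono_generate)
  moreover have "c x \<in> c ` generate G ?C" using Suc.prems by simp
  ultimately show ?case using generate_img[OF C] by auto
qed

locale nilpotent_minimal_set = polynomial_retract A \<beta> U r
  for A :: "('s, 'a::finite) ualgebra" and \<beta> U r +
  fixes \<delta> \<theta> :: "'a rel" and k :: nat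
  assumes cov: "covers A \<delta> \<theta>" and U_Min: "U \<in> Min_sets A \<delta> \<theta>"
    and nil: "acts_as_nilpotent_group (Tw A \<beta> U) U k"
begin

abbreviation "T \<equiv> Tw_cube A \<beta> U 1"

lemma T_Bij: "T \<subseteq> Bij U" and T_group: "group TwG" and T_class: "lower_central TwG k = {\<one>\<^bsub>TwG\<^esub>}"
  using nil unfolding acts_as_nilpotent_group_def nilpotent_group_class_le_def Tw_eq by blast+

lemma con: "\<delta> \<in> Con A" "\<theta> \<in> Con A" and sub: "\<delta> \<subseteq> \<theta>"
  using cov unfolding covers_def by auto

lemmas d_refl = Con_refl[OF con(1)] and d_sym = Con_sym[OF con(1)] and d_trans = Con_trans[OF con(1)]
lemmas t_refl = Con_refl[OF con(2)] and t_sym = Con_sym[OF con(2)] and t_trans = Con_trans[OF con(2)]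

lemma d_t: "(x, y) \<in> \<delta> \<Longrightarrow> (x, y) \<in> \<theta>"
  using sub by blast

lemma T_closed: "g \<in> T \<Longrightarrow> x \<in> U \<Longrightarrow> g x \<in> U"
  by (rule Tw_cube_closed)

lemma T_Con:
  assumes "g \<in> T" and "\<gamma> \<in> Con A" and "x \<in> U" "y \<in> U" "(x, y) \<in> \<gamma>"
  shows "(g x, g y) \<in> \<gamma>"
proof -
  obtain f where "g = restrict f U" "f \<in> Pol1 A"
    using assms(1) unfolding Tw_eq[symmetric] Tw_def by blast
  then show ?thesis using Pol1_Con[of f A \<gamma> x y] assms by simp
qed

lemmas T_d = T_Con[OF _ con(1)] and T_t = T_Con[OF _ con(2)]

lemma T_mult: "f \<in> T \<Longrightarrow> g \<in> T \<Longrightarrow> f \<otimes>\<^bsub>TwG\<^esub> g \<in> T"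
  using group.is_monoid[OF T_group] monoid.m_closed[of TwG f g] by simp

lemma T_inv: "f \<in> T \<Longrightarrow> inv\<^bsub>TwG\<^esub> f \<in> T"
  using group.inv_closed[OF T_group, of f] by simp

lemma T_mult_apply: "f \<in> T \<Longrightarrow> g \<in> T \<Longrightarrow> x \<in> U \<Longrightarrow> (f \<otimes>\<^bsub>TwG\<^esub> g) x = f (g x)"
  by (subst BijGroup_simps[OF T_Bij]) (simp_all add: compose_def)

lemma T_inv_apply:
  assumes "f \<in> T" and "x \<in> U"
  shows "(inv\<^bsub>TwG\<^esub> f) (f x) = x"
proof -
  have "(inv\<^bsub>TwG\<^esub> f \<otimes>\<^bsub>TwG\<^esub> f) x = \<one>\<^bsub>TwG\<^esub> x"
    using group.l_inv[OF T_group, of f] assms(1) by simp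
  then show ?thesis
    using T_mult_apply[OF T_inv[OF assms(1)] assms] assms(2) unfolding TwG_one by simp
qed

lemma T_apply_inv:
  assumes "f \<in> T" and "x \<in> U"
  shows "f ((inv\<^bsub>TwG\<^esub> f) x) = x"
proof -
  have "(f \<otimes>\<^bsub>TwG\<^esub> inv\<^bsub>TwG\<^esub> f) x = \<one>\<^bsub>TwG\<^esub> x"
    using group.r_inv[OF T_group, of f] assms(1) by simp
  then show ?thesis
    using T_mult_apply[OF assms(1) T_inv[OF assms(1)] assms(2)] assms(2) unfolding TwG_one by simp
qed

text \<open>By minimality \<open>t\<close> after \<open>r\<close> has image \<open>U\<close>, so
  \<open>t\<close> maps the finite set \<open>U\<close> onto itself.\<close>

lemma perm_or_collapse:
  assumes "t \<in> Pol1 A" and "range t \<subseteq> U" and "x \<in> U" "y \<in> U" "(x, y) \<in> \<theta>" "(t x, t y) \<notin> \<delta>"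
  shows "inj_on t U"
proof -
  have "range (\<lambda>x. t (r x)) = U"
  proof (rule Min_sets_minimal[OF U_Min Pol1_comp[OF assms(1) r_Pol1] assms(5)])
    show "(t (r x), t (r y)) \<notin> \<delta>" using assms by (simp add: r_fix)
  qed (use assms(2) in auto)
  moreover have "range (\<lambda>x. t (r x)) = t ` U" using r_range by (metis image_image)
  ultimately have "card (t ` U) = card U" by simp
  then show ?thesis by (rule eq_card_imp_inj_on[rotated]) simp
qed

text \<open>The inverse is a power of \<open>t\<close>, followed by \<open>r\<close> because this
  may be the zeroth power, whose range need not lie in \<open>U\<close>.\<close>

lemma polynomial_inverse:
  assumes t: "t \<in> Pol1 A" and "range t \<subseteq> U" and "inj_on t U"
  obtains q where "q \<in> Pol1 A" "range q \<subseteq> U" "\<And>x. x \<in> U \<Longrightarrow> q (t x) = x" "\<And>x. x \<in> U \<Longrightarrow> t (q x) = x"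
proof -
  obtain N where N: "N \<ge> 1" "\<And>(f :: 'a \<Rightarrow> 'a) x. (f ^^ N) ((f ^^ N) x) = (f ^^ N) x"
    using exists_idempotent_power by blast
  obtain M where M: "N = Suc M" using N(1) by (cases N) auto
  have tU: "t x \<in> U" for x using assms(2) by blast
  have fix_N: "(t ^^ N) x = x" if "x \<in> U" for x
    using funpow_identity_on[OF N(2) assms(3)] tU that by blast
  let ?q = "\<lambda>x. r ((t ^^ M) x)"
  show thesis
  proof (rule that)
    show "?q \<in> Pol1 A" by (rule Pol1_comp[OF r_Pol1 Pol1_funpow[OF t]])
    show "range ?q \<subseteq> U" by auto
    show "?q (t x) = x" if "x \<in> U" for x
      using fix_N[OF that] that by (simp add: M funpow_swap1 r_fix)
    show "t (?q x) = x" if "x \<in> U" for x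
      using fix_N[OF that] funpow_closed[of U t x M] tU that by (simp add: M r_fix)
  qed
qed

text \<open>The quotient is the second twin after the inverse of the first; replacing the second
  twin by the first turns it into the identity, so it is in the twin group.\<close>

lemma twin_quotient:
  assumes F: "F \<in> Fam A [\<beta>]" and FU: "\<And>i. F i \<in> U" and inj: "inj_on (\<lambda>x. F (\<lambda>_. False, x)) U"
  shows "\<exists>g\<in>T. \<forall>x\<in>U. g (F (\<lambda>_. False, x)) = F (\<lambda>_. True, x)"
proof -
  let ?t = "\<lambda>x. F (\<lambda>_. False, x)"
  have "?t \<in> Pol1 A"
    using F unfolding Pol1_eq_Clo by (rule Fam_subst) (auto intro: Clo.gen)
  then obtain q where q: "q \<in> Pol1 A" "range q \<subseteq> U" "\<And>x. x \<in> U \<Longrightarrow> q (?t x) = x"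
    "\<And>x. x \<in> U \<Longrightarrow> ?t (q x) = x"
    using polynomial_inverse[of ?t] FU inj by blast
  let ?g = "\<lambda>x\<in>U. F (\<lambda>_. True, q x)"
  have "?g \<in> T"
  proof (rule Tw_cubeI[where F = "\<lambda>i. F (fst i, q (snd i))"])
    show "(\<lambda>i. F (fst i, q (snd i))) \<in> Fam A (replicate 1 \<beta>)"
      using Fam_comp[OF F Fam_Pol1[OF q(1) Fam_snd]] by simp
  next
    fix e :: "nat \<Rightarrow> bool" and j x assume "j < 1" "\<not> e j" "x \<in> U"
    moreover from this have "F (e, q x) = ?t (q x)" by (intro Fam_cong[OF F]) simp
    ultimately show "F (fst (e, x), q (snd (e, x))) = x" using q(4) by simp
  next
    fix e :: "nat \<Rightarrow> bool" and x assume "\<And>j. j < 1 \<Longrightarrow> e j" "x \<in> U"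
    moreover from this have "F (e, q x) = F (\<lambda>_. True, q x)" by (intro Fam_cong[OF F]) simp
    ultimately show "F (fst (e, x), q (snd (e, x))) = ?g x" by simp
  qed (use FU in simp_all)
  moreover have "?g (?t x) = F (\<lambda>_. True, x)" if "x \<in> U" for x
    using q(3)[OF that] FU by simp
  ultimately show ?thesis by blast
qed

text \<open>Reversing the direction exchanges the twins; the quotient then writes the false end as a
  permutation from \<open>T\<close> after the injective true end.\<close>

lemma twin_inj:
  assumes F: "F \<in> Fam A [\<beta>]" and FU: "\<And>i. F i \<in> U" and inj: "inj_on (\<lambda>x. F (\<lambda>_. True, x)) U"
  shows "inj_on (\<lambda>x. F (\<lambda>_. False, x)) U"
proof -
  let ?F = "\<lambda>i. F (\<lambda>_. \<not> fst i 0, snd i)"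
  have "?F \<in> Fam A [\<beta>]"
    unfolding Fam_def
  proof (rule Fam_subst[OF F])
    fix j x y assume "j < length [\<beta>]" "(x, y) \<in> [\<beta>] ! j"
    then have "(\<lambda>i. if fst i 0 then x else y) \<in> edge_maps [\<beta>] fst"
      using Con_sym[OF \<beta>_Con] by (intro edge_mapsI) auto
    moreover have "(\<lambda>i. if fst (\<lambda>_. \<not> fst i 0, snd i) j then y else x) =
        (\<lambda>i :: (nat \<Rightarrow> bool) \<times> 'a. if fst i 0 then x else y)"
      by auto
    ultimately show "(\<lambda>i. if fst (\<lambda>_. \<not> fst i 0, snd i) j then y else x)
        \<in> Clo A (insert snd (edge_maps [\<beta>] fst))"
      by (simp only:) (intro Clo.gen insertI2)
  qed (auto simp: edge_maps_def intro: Clo.gen)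
  from twin_quotient[OF this] obtain g where
    g: "g \<in> T" "\<And>x. x \<in> U \<Longrightarrow> g (F (\<lambda>_. True, x)) = F (\<lambda>_. False, x)"
    using FU inj by auto
  have "inj_on g U" using g(1) T_Bij Bij_iff_inj[of g U] by blast
  then have "inj_on (\<lambda>x. g (F (\<lambda>_. True, x))) U"
    using comp_inj_on[OF inj, of g] FU unfolding comp_def by (metis image_subsetI inj_on_subset)
  then show ?thesis using g(2) by (simp cong: inj_on_cong)
qed

text \<open>Normality of the twin group: conjugating a twin family by a polynomial permutation keeps
  the identity at its false vertex.\<close>

lemma T_conj_hom:
  assumes p: "p \<in> Pol1 A" "range p \<subseteq> U" and q: "q \<in> Pol1 A" "range q \<subseteq> U"
    and inverse: "\<And>x. x \<in> U \<Longrightarrow> q (p x) = x" "\<And>x. x \<in> U \<Longrightarrow> p (q x) = x"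
  shows "(\<lambda>z. \<lambda>x\<in>U. p (z (q x))) \<in> hom TwG TwG"
proof -
  have pU: "p x \<in> U" and qU: "q x \<in> U" for x using p q by blast+
  have mem: "(\<lambda>x\<in>U. p (z (q x))) \<in> T" if z: "z \<in> T" for z
  proof -
    obtain F where F: "F \<in> Fam A (replicate 1 \<beta>)" "\<And>i. F i \<in> U"
      "\<And>e j x. j < 1 \<Longrightarrow> \<not> e j \<Longrightarrow> x \<in> U \<Longrightarrow> F (e, x) = x"
      "\<And>e x. (\<And>j. j < 1 \<Longrightarrow> e j) \<Longrightarrow> x \<in> U \<Longrightarrow> F (e, x) = z x"
      using z by (rule Tw_cubeE) blast
    have "(\<lambda>i. p (F (fst i, q (snd i)))) \<in> Fam A (replicate 1 \<beta>)"
      by (rule Fam_Pol1[OF p(1) Fam_comp[OF F(1) Fam_Pol1[OF q(1) Fam_snd]]])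
    then show ?thesis
      using F(3,4) inverse pU qU
      by (intro Tw_cubeI[where F = "\<lambda>i. p (F (fst i, q (snd i)))"]) auto
  qed
  have "(\<lambda>x\<in>U. p ((z \<otimes>\<^bsub>TwG\<^esub> z') (q x))) =
      (\<lambda>x\<in>U. p (z (q x))) \<otimes>\<^bsub>TwG\<^esub> (\<lambda>x\<in>U. p (z' (q x)))"
    if z: "z \<in> T" "z' \<in> T" for z z'
  proof -
    have "(\<lambda>x\<in>U. p (z (q x))) \<otimes>\<^bsub>TwG\<^esub> (\<lambda>x\<in>U. p (z' (q x))) =
        compose U (\<lambda>x\<in>U. p (z (q x))) (\<lambda>x\<in>U. p (z' (q x)))"
      by (intro BijGroup_simps[OF T_Bij] mem z)
    also have "\<dots> = (\<lambda>x\<in>U. p (z (z' (q x))))"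
      using pU qU T_closed[OF z(2)] by (auto simp: compose_def inverse)
    also have "\<dots> = (\<lambda>x\<in>U. p ((z \<otimes>\<^bsub>TwG\<^esub> z') (q x)))"
      using T_mult_apply[OF z qU] by (intro restrict_ext) (simp only:)
    finally show ?thesis by simp
  qed
  then show ?thesis using mem by (intro homI) simp_all
qed

text \<open>Primitivity of the minimal set: \<open>\<theta>\<close> is generated by \<open>\<delta>\<close> and the single pair \<open>(u, z\<^sub>0 u)\<close>, and each
  link of the resulting chain from \<open>v\<close> to \<open>w\<close> is realised modulo \<open>\<delta>\<close> by a conjugate of \<open>z\<^sub>0\<close> or its inverse.\<close>

lemma lower_central_transitive:
  assumes z0: "z0 \<in> lower_central TwG i" and u: "u \<in> U" "(u, z0 u) \<in> \<theta>" "(u, z0 u) \<notin> \<delta>"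
    and vw: "v \<in> U" "w \<in> U" "(v, w) \<in> \<theta>"
  shows "\<exists>z\<in>lower_central TwG i. (z v, w) \<in> \<delta>"
proof -
  let ?lc = "lower_central TwG i"
  let ?L = "\<delta> \<union> {(h u, h (z0 u)) | h. h \<in> Pol1 A} \<union> {(h (z0 u), h u) | h. h \<in> Pol1 A}"
  have lc: "subgroup ?lc TwG" by (rule lower_central_subgroup[OF T_group])
  have lcT: "?lc \<subseteq> T" using subgroup.subset[OF lc] by simp
  have z0T: "z0 \<in> T" using z0 lcT by blast
  have z0u: "z0 u \<in> U" by (rule T_closed[OF z0T u(1)])
  have link: "(\<exists>z\<in>?lc. z (r (h u)) = r (h (z0 u))) \<or> (r (h u), r (h (z0 u))) \<in> \<delta>"
    if h: "h \<in> Pol1 A" for h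
  proof (rule disjCI)
    let ?p = "\<lambda>x. r (h x)"
    assume nd: "(?p u, ?p (z0 u)) \<notin> \<delta>"
    have p: "?p \<in> Pol1 A" "range ?p \<subseteq> U" using Pol1_comp[OF r_Pol1 h] by auto
    have "inj_on ?p U" by (rule perm_or_collapse[OF p u(1) z0u u(2) nd])
    then obtain q where q: "q \<in> Pol1 A" "range q \<subseteq> U" "\<And>x. x \<in> U \<Longrightarrow> q (?p x) = x"
      "\<And>x. x \<in> U \<Longrightarrow> ?p (q x) = x"
      using polynomial_inverse[OF p] by blast
    have "(\<lambda>x\<in>U. ?p (z0 (q x))) \<in> ?lc"
      using lower_central_hom[OF T_group T_conj_hom[OF p q] z0] .
    then show "\<exists>z\<in>?lc. z (?p u) = ?p (z0 u)"
      by (rule bexI[rotated]) (simp add: q(3) u(1))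
  qed
  have move: "\<exists>z'\<in>?lc. (z' v, r y') \<in> \<delta>"
    if z: "z \<in> ?lc" "(z v, r y) \<in> \<delta>" and z1: "z1 \<in> ?lc" "z1 (r y) = r y'" for z z1 y y'
  proof (rule bexI)
    have T: "z \<in> T" "z1 \<in> T" using z(1) z1(1) lcT by blast+
    show "(z1 \<otimes>\<^bsub>TwG\<^esub> z) \<in> ?lc" by (rule subgroup.m_closed[OF lc z1(1) z(1)])
    have "(z1 (z v), z1 (r y)) \<in> \<delta>"
      by (rule T_d[OF T(2) T_closed[OF T(1) vw(1)] r_in z(2)])
    then show "((z1 \<otimes>\<^bsub>TwG\<^esub> z) v, r y') \<in> \<delta>"
      unfolding T_mult_apply[OF T(2,1) vw(1)] z1(2) .
  qed
  have "(v, w) \<in> ?L\<^sup>*"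
    using covers_chain[OF cov u(2,3)] vw(3) by blast
  \<comment> \<open>The chain may leave \<open>U\<close>, so its image under \<open>r\<close> is
    followed instead.\<close>
  then have "\<exists>z\<in>?lc. (z v, r w) \<in> \<delta>"
  proof induction
    case base
    have "(\<one>\<^bsub>TwG\<^esub> v, r v) \<in> \<delta>" unfolding TwG_one using vw(1) r_fix d_refl by simp
    then show ?case using subgroup.one_closed[OF lc] by blast
  next
    case (step y y')
    then obtain z where z: "z \<in> ?lc" "(z v, r y) \<in> \<delta>" by blast
    have collapsed: ?case if "(r y, r y') \<in> \<delta>"
      using z d_trans[OF z(2) that] by blast
    from step(2) consider "(y, y') \<in> \<delta>"
      | h where "h \<in> Pol1 A" "y = h u" "y' = h (z0 u)" | h where "h \<in> Pol1 A" "y = h (z0 u)" "y' = h u"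
      by blast
    then show ?case
    proof cases
      case 1
      then show ?thesis using collapsed Pol1_Con[OF r_Pol1 con(1)] by blast
    next
      case (2 h)
      then show ?thesis using collapsed link[OF 2(1)] move[OF z] by auto
    next
      case (3 h)
      from link[OF 3(1)] show ?thesis
      proof
        assume "(r (h u), r (h (z0 u))) \<in> \<delta>"
        then show ?thesis using collapsed d_sym 3 by blast
      next
        assume "\<exists>z\<in>?lc. z (r (h u)) = r (h (z0 u))"
        then obtain z1 where z1: "z1 \<in> ?lc" "z1 (r y') = r y" using 3 by auto
        have "inv\<^bsub>TwG\<^esub> z1 \<in> ?lc" by (rule subgroup.m_inv_closed[OF lc z1(1)])
        moreover have "(inv\<^bsub>TwG\<^esub> z1) (r y) = r y'"
          using T_inv_apply[of z1 "r y'"] z1 lcT by auto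
        ultimately show ?thesis by (rule move[OF z])
      qed
    qed
  qed
  then show ?thesis using vw(2) by (simp add: r_fix)
qed

text \<open>The last term of the lower central series that still acts nontrivially on the block is
  transitive on its \<open>\<delta>\<close>-classes and commutes with \<open>g\<close> modulo \<open>\<delta>\<close>.\<close>

lemma T_fixed_block:
  assumes g: "g \<in> T" and v: "v \<in> U" "(g v, v) \<in> \<delta>" and w: "w \<in> U" "(v, w) \<in> \<theta>"
  shows "(g w, w) \<in> \<delta>"
proof (rule ccontr)
  assume neg: "(g w, w) \<notin> \<delta>"
  \<comment> \<open>Members of the term that preserve the \<theta>-block of \<open>v\<close> fix all
    \<delta>-classes of its part in \<open>U\<close>. This fails for the whole group by
    \<open>neg\<close> and holds for the last term.\<close>
  define trivial where "trivial i \<longleftrightarrow> (\<forall>z\<in>lower_central TwG i. (z v, v) \<in> \<theta> \<longrightarrow>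
    (\<forall>x\<in>U. (v, x) \<in> \<theta> \<longrightarrow> (z x, x) \<in> \<delta>))" for i
  have lcT: "z \<in> T" if "z \<in> lower_central TwG i" for z i
    using subgroup.subset[OF lower_central_subgroup[OF T_group]] that by auto
  have "\<not> trivial 0"
    using g v w d_t[OF v(2)] neg unfolding trivial_def by auto
  moreover have "trivial k"
    unfolding trivial_def T_class TwG_one using d_refl by simp
  ultimately obtain i where i: "\<not> trivial i" "trivial (Suc i)"
    using nat_induct[of "\<lambda>i. \<not> trivial i" k] by blast
  then obtain z0 u where z0: "z0 \<in> lower_central TwG i" "(z0 v, v) \<in> \<theta>" and u: "u \<in> U" "(v, u) \<in> \<theta>"
    and nd: "(z0 u, u) \<notin> \<delta>" unfolding trivial_def by blast
  have "(z0 v, z0 u) \<in> \<theta>" using T_t[OF lcT[OF z0(1)] v(1) u] .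
  then have "(u, z0 u) \<in> \<theta>" using z0(2) u(2) t_sym t_trans by blast
  then obtain z where z: "z \<in> lower_central TwG i" "(z v, w) \<in> \<delta>"
    using lower_central_transitive[OF z0(1) u(1) _ _ v(1) w] nd d_sym by blast
  have zT: "z \<in> T" using lcT[OF z(1)] .
  \<comment> \<open>\<open>?c\<close> sends \<open>g (z v)\<close> to \<open>z (g v)\<close> and
    lies in the next term, which is trivial on the block. Hence \<open>g w\<close>,
    \<open>g (z v)\<close>, \<open>z (g v)\<close>, \<open>z v\<close> and \<open>w\<close> are
    successively \<delta>-related.\<close>
  let ?c = "z \<otimes>\<^bsub>TwG\<^esub> g \<otimes>\<^bsub>TwG\<^esub> inv\<^bsub>TwG\<^esub> z \<otimes>\<^bsub>TwG\<^esub> inv\<^bsub>TwG\<^esub> g"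
  have c: "?c \<in> lower_central TwG (Suc i)"
    unfolding lower_central.simps
    by (rule generate.incl) (use z(1) g in auto)
  have zv: "z v \<in> U" and gv: "g v \<in> U" using T_closed zT g v(1) by blast+
  have gzv: "g (z v) \<in> U" by (rule T_closed[OF g zv])
  have cx: "?c (g (z v)) = z (g v)"
    using gzv zv v(1) gv T_closed[OF zT] T_closed[OF g] zT g
    by (simp only: T_mult_apply T_mult T_inv T_inv_apply)
  have zv_v: "(v, z v) \<in> \<theta>"
    using w(2) d_t[OF z(2)] t_sym t_trans by blast
  have x_v: "(v, g (z v)) \<in> \<theta>"
    using T_t[OF g v(1) zv zv_v] d_t[OF v(2)] t_sym t_trans by blast
  have zgv: "(z (g v), z v) \<in> \<delta>" by (rule T_d[OF zT gv v])
  have "(?c v, ?c (g (z v))) \<in> \<theta>"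
    using T_t[OF lcT[OF c] v(1) gzv x_v] .
  then have "(?c v, v) \<in> \<theta>"
    unfolding cx using d_t[OF zgv] zv_v t_sym t_trans by blast
  then have "(z (g v), g (z v)) \<in> \<delta>"
    using i(2) c gzv x_v cx unfolding trivial_def by metis
  moreover have "(g (z v), g w) \<in> \<delta>" by (rule T_d[OF g zv w(1) z(2)])
  ultimately have "(g w, w) \<in> \<delta>"
    using zgv z(2) d_sym d_trans by blast
  then show False using neg by contradiction
qed

end

section \<open>Links between the values of two twins along a chain\<close>

context nilpotent_minimal_set
begin

text \<open>Unprimed points are values of the first twin, primed ones those of the second at the
  same arguments. The first alternative covers links along which both twins collapse.\<close>

definition twin_link :: "'a \<Rightarrow> 'a \<Rightarrow> 'a \<Rightarrow> 'a \<Rightarrow> bool" where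
  "twin_link p p' q q' \<longleftrightarrow> (p, q) \<in> \<delta> \<and> (p', q') \<in> \<delta> \<or>
     (\<exists>g\<in>T. (g p, p') \<in> \<delta> \<and> (g q, q') \<in> \<delta>)"

lemma twin_link_sym: "twin_link p p' q q' \<Longrightarrow> twin_link q q' p p'"
  unfolding twin_link_def using d_sym by blast

text \<open>The main case has two group elements \<open>g\<close> and \<open>h\<close> that agree at
  the common point \<open>q\<close> modulo \<delta>; a twin fixing one class of the block fixes all,
  so they also agree at \<open>p\<close>.\<close>

lemma twin_link_trans:
  assumes pq: "twin_link p p' q q'" and qs: "twin_link q q' s s'"
    and U: "p \<in> U" "q \<in> U" "s \<in> U" and th: "(p, q) \<in> \<theta>"
  shows "twin_link p p' s s'"
proof -
  consider (1) "(p, q) \<in> \<delta>" "(p', q') \<in> \<delta>" "(q, s) \<in> \<delta>" "(q', s') \<in> \<delta>"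
    | (2) g where "(p, q) \<in> \<delta>" "(p', q') \<in> \<delta>" "g \<in> T" "(g q, q') \<in> \<delta>" "(g s, s') \<in> \<delta>"
    | (3) g where "g \<in> T" "(g p, p') \<in> \<delta>" "(g q, q') \<in> \<delta>" "(q, s) \<in> \<delta>" "(q', s') \<in> \<delta>"
    | (4) g h where "g \<in> T" "(g p, p') \<in> \<delta>" "(g q, q') \<in> \<delta>"
        "h \<in> T" "(h q, q') \<in> \<delta>" "(h s, s') \<in> \<delta>"
    using pq qs unfolding twin_link_def by blast
  then show ?thesis
  proof cases
    case 1
    then show ?thesis unfolding twin_link_def using d_trans by blast
  next
    case (2 g)
    then have "(g p, p') \<in> \<delta>"
      using T_d[OF 2(3) U(1,2)] d_sym d_trans by blast
    then show ?thesis unfolding twin_link_def using 2 by blast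
  next
    case (3 g)
    then have "(g s, s') \<in> \<delta>"
      using T_d[OF 3(1) U(2,3)] d_sym d_trans by blast
    then show ?thesis unfolding twin_link_def using 3 by blast
  next
    case (4 g h)
    \<comment> \<open>\<open>?k\<close> fixes the class of \<open>q\<close>, hence that of
      \<open>p\<close>, so \<open>h\<close> can replace \<open>g\<close> at
      \<open>p\<close>.\<close>
    let ?k = "inv\<^bsub>TwG\<^esub> h \<otimes>\<^bsub>TwG\<^esub> g"
    have ih: "inv\<^bsub>TwG\<^esub> h \<in> T" by (rule T_inv[OF 4(4)])
    have k: "?k \<in> T" by (rule T_mult[OF ih 4(1)])
    have app: "?k x = (inv\<^bsub>TwG\<^esub> h) (g x)" if "x \<in> U" for x
      by (rule T_mult_apply[OF ih 4(1) that])
    have "(g q, h q) \<in> \<delta>" using 4(3,5) d_sym d_trans by blast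
    from T_d[OF ih T_closed[OF 4(1) U(2)] T_closed[OF 4(4) U(2)] this]
    have "(?k q, q) \<in> \<delta>" using T_inv_apply[OF 4(4) U(2)] app[OF U(2)] by simp
    from T_fixed_block[OF k U(2) this U(1) t_sym[OF th]] have kp: "(?k p, p) \<in> \<delta>" .
    have "h (?k p) = g p"
      unfolding app[OF U(1)] by (rule T_apply_inv[OF 4(4) T_closed[OF 4(1) U(1)]])
    then have "(g p, h p) \<in> \<delta>"
      using T_d[OF 4(4) T_closed[OF k U(1)] U(1) kp] by simp
    then have "(h p, p') \<in> \<delta>" using 4(2) d_sym d_trans by blast
    then show ?thesis unfolding twin_link_def using 4 by blast
  qed
qed

lemma nontrivial_pair: "\<exists>u\<in>U. \<exists>v\<in>U. (u, v) \<in> \<theta> \<and> (u, v) \<notin> \<delta>"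
proof -
  obtain f where f: "f \<in> Pol1 A" "range f = U" "\<not> map_prod f f ` \<theta> \<subseteq> \<delta>"
    using Min_sets_image[OF U_Min] by blast
  then obtain a b where "(a, b) \<in> \<theta>" "(f a, f b) \<notin> \<delta>" by auto
  then show ?thesis using f(2) Pol1_Con[OF f(1) con(2)] by blast
qed

text \<open>Otherwise \<open>r\<close> would collapse every polynomial image of
  \<open>(x, y)\<close>, and with them a chain joining a \<theta>-pair of \<open>U\<close> outside
  \<delta>.\<close>

lemma separation:
  assumes "(x, y) \<in> \<theta>" and "(x, y) \<notin> \<delta>"
  shows "\<exists>p\<in>Pol1 A. range p \<subseteq> U \<and> (p x, p y) \<notin> \<delta>"
proof (rule ccontr)
  assume neg: "\<not> ?thesis"
  have coll: "(r (h x), r (h y)) \<in> \<delta>" if "h \<in> Pol1 A" for h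
    using neg Pol1_comp[OF r_Pol1 that] by auto
  obtain u v where uv: "u \<in> U" "v \<in> U" "(u, v) \<in> \<theta>" "(u, v) \<notin> \<delta>" using nontrivial_pair by blast
  then have "(u, v) \<in> (\<delta> \<union> {(h x, h y) | h. h \<in> Pol1 A} \<union> {(h y, h x) | h. h \<in> Pol1 A})\<^sup>*"
    using covers_chain[OF cov assms] by simp
  then have "(r u, r v) \<in> \<delta>"
  proof induction
    case base
    then show ?case by (rule d_refl)
  next
    case (step z w)
    from step(2) have "(r z, r w) \<in> \<delta>"
      using coll Pol1_Con[OF r_Pol1 con(1)] d_sym by blast
    with step(3) show ?case by (rule d_trans)
  qed
  then show False using uv by (simp add: r_fix)
qed

lemma Fam_vertex_Pol1: "F \<in> Fam A [\<beta>] \<Longrightarrow> (\<lambda>x. F (e, x)) \<in> Pol1 A"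
  unfolding Pol1_eq_Clo by (rule Fam_subst) (auto intro: Clo.gen)

text \<open>A \<theta>-pair of \<open>U\<close> outside \<delta> generates \<theta> over \<delta>,
  so its polynomial images form a chain from \<open>x\<close> to \<open>y\<close>; the links compose
  by transitivity.\<close>

lemma twin_link_Fam:
  assumes F: "F \<in> Fam A [\<beta>]" and FU: "\<And>i. F i \<in> U" and xy: "(x, y) \<in> \<theta>"
  shows "twin_link (F (\<lambda>_. False, x)) (F (\<lambda>_. True, x)) (F (\<lambda>_. False, y)) (F (\<lambda>_. True, y))"
proof -
  obtain u v where uv: "u \<in> U" "v \<in> U" "(u, v) \<in> \<theta>" "(u, v) \<notin> \<delta>" using nontrivial_pair by blast
  let ?link = "\<lambda>x y. twin_link (F (\<lambda>_. False, x)) (F (\<lambda>_. True, x)) (F (\<lambda>_. False, y)) (F (\<lambda>_. True, y))"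
  have delta_link: "?link a b" if "(a, b) \<in> \<delta>" for a b
    unfolding twin_link_def using Pol1_Con[OF Fam_vertex_Pol1[OF F] con(1) that] by blast
  have base_link: "?link (h u) (h v)" if h: "h \<in> Pol1 A" for h
  proof -
    let ?G = "\<lambda>i. F (fst i, h (snd i))"
    have G: "?G \<in> Fam A [\<beta>]" by (rule Fam_comp[OF F Fam_Pol1[OF h Fam_snd]])
    have GU: "\<And>i. ?G i \<in> U" by (rule FU)
    have inj: "inj_on (\<lambda>x. ?G (e, x)) U" if "(?G (e, u), ?G (e, v)) \<notin> \<delta>" for e
      by (rule perm_or_collapse[OF Fam_vertex_Pol1[OF G] _ uv(1-3) that]) (use GU in blast)
    show ?thesis
    proof (cases "(?G (\<lambda>_. False, u), ?G (\<lambda>_. False, v)) \<in> \<delta> \<and> (?G (\<lambda>_. True, u), ?G (\<lambda>_. True, v)) \<in> \<delta>")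
      case True
      then show ?thesis unfolding twin_link_def by simp
    next
      case False
      \<comment> \<open>Some end does not collapse and so permutes \<open>U\<close>; then the false
        end does too, and the ends differ by a member of \<open>T\<close>.\<close>
      then have "inj_on (\<lambda>x. ?G (\<lambda>_. False, x)) U"
        using inj twin_inj[OF G GU] by blast
      from twin_quotient[OF G GU this] obtain g where
        g: "g \<in> T" "\<forall>x\<in>U. g (?G (\<lambda>_. False, x)) = ?G (\<lambda>_. True, x)" by blast
      then have "g (F (\<lambda>_. False, h u)) = F (\<lambda>_. True, h u)" "g (F (\<lambda>_. False, h v)) = F (\<lambda>_. True, h v)"
        using uv(1,2) by auto
      then show ?thesis
        unfolding twin_link_def using g(1) d_refl by (metis (no_types))
    qed
  qed
  have "(x, y) \<in> (\<delta> \<union> {(h u, h v) | h. h \<in> Pol1 A} \<union> {(h v, h u) | h. h \<in> Pol1 A})\<^sup>*"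
    using covers_chain[OF cov uv(3,4)] xy by simp
  then show ?thesis
  proof induction
    case base
    then show ?case by (rule delta_link[OF d_refl])
  next
    case (step y z)
    have "?link y z"
      using step(2) delta_link base_link twin_link_sym by blast
    moreover have "(x, y) \<in> \<theta>"
      using step(1) covers_chain[OF cov uv(3,4)] by simp
    then have "(F (\<lambda>_. False, x), F (\<lambda>_. False, y)) \<in> \<theta>"
      by (rule Pol1_Con[OF Fam_vertex_Pol1[OF F] con(2)])
    ultimately show ?case using twin_link_trans[OF step(3) _ FU FU FU] by blast
  qed
qed

text \<open>Since the universe is finite, one variable for each pair of elements suffices to represent
  the \<open>\<theta>\<close>-edges of all matrices.\<close>

abbreviation pair_polys :: "((nat \<Rightarrow> bool) \<times> ('a \<times> 'a \<Rightarrow> 'a) \<Rightarrow> 'a) set" where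
  "pair_polys \<equiv> Clo A (range (\<lambda>j i. snd i j) \<union> edge_maps [\<beta>] fst)"

text \<open>Fixing all variables except \<open>j\<close> leaves a one-dimensional family of unary
  polynomials.\<close>

lemma twin_link_update:
  assumes M: "M \<in> pair_polys" and MU: "\<And>i. M i \<in> U" and xy: "(\<xi> j, y) \<in> \<theta>"
  shows "twin_link (M (\<lambda>_. False, \<xi>)) (M (\<lambda>_. True, \<xi>))
    (M (\<lambda>_. False, \<xi>(j := y))) (M (\<lambda>_. True, \<xi>(j := y)))"
proof -
  let ?F = "\<lambda>i. M (fst i, \<xi>(j := snd i))"
  have "?F \<in> Fam A [\<beta>]"
    unfolding Fam_def
  proof (rule Clo_subst[OF M])
    fix g :: "(nat \<Rightarrow> bool) \<times> ('a \<times> 'a \<Rightarrow> 'a) \<Rightarrow> 'a"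
    assume "g \<in> range (\<lambda>j i. snd i j) \<union> edge_maps [\<beta>] fst"
    then consider l where "g = (\<lambda>i. snd i l)" | "g \<in> edge_maps [\<beta>] fst" by blast
    then show "(\<lambda>i. g (fst i, \<xi>(j := snd i))) \<in> Clo A (insert snd (edge_maps [\<beta>] fst))"
    proof cases
      case (1 l)
      then show ?thesis by (cases "l = j") (auto intro: Clo.gen)
    next
      case 2
      then show ?thesis
      proof (cases rule: edge_mapsE)
        case (const c)
        then show ?thesis by (auto intro: Clo.gen)
      next
        case (edge l a b)
        then have "(\<lambda>i. if fst i l then b else a) \<in> edge_maps [\<beta>] fst"
          by (intro edge_mapsI)
        then show ?thesis unfolding edge(3) fst_conv by (intro Clo.gen insertI2)
      qed
    qed
  qed
  from twin_link_Fam[OF this MU xy] show ?thesis by simp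
qed

lemma pair_polys_Con:
  assumes "M \<in> pair_polys" and "\<And>j. (\<xi> j, \<eta> j) \<in> \<theta>"
  shows "(M (e, \<xi>), M (e, \<eta>)) \<in> \<theta>"
  using assms(1) by (rule Clo_Con[OF _ con(2)]) (auto elim!: edge_mapsE intro: t_refl assms(2))

text \<open>The finitely many variables are switched from \<open>\<xi>\<close> to
  \<open>\<eta>\<close> one at a time; all intermediate values at a vertex stay in one
  \<theta>-block, so the links compose.\<close>

lemma twin_link_assignments:
  assumes M: "M \<in> pair_polys" and MU: "\<And>i. M i \<in> U" and xy: "\<And>j. (\<xi> j, \<eta> j) \<in> \<theta>"
  shows "twin_link (M (\<lambda>_. False, \<xi>)) (M (\<lambda>_. True, \<xi>)) (M (\<lambda>_. False, \<eta>)) (M (\<lambda>_. True, \<eta>))"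
proof -
  have "twin_link (M (\<lambda>_. False, \<xi>)) (M (\<lambda>_. True, \<xi>))
      (M (\<lambda>_. False, override_on \<xi> \<eta> J)) (M (\<lambda>_. True, override_on \<xi> \<eta> J))" for J
    using finite[of J]
  proof induction
    case empty
    then show ?case unfolding twin_link_def using d_refl by simp
  next
    case (insert j J)
    let ?\<zeta> = "override_on \<xi> \<eta> J"
    have upd: "override_on \<xi> \<eta> (insert j J) = ?\<zeta>(j := \<eta> j)"
      by (auto simp: override_on_def)
    have "(?\<zeta> j, \<eta> j) \<in> \<theta>" using insert(2) xy by (simp add: override_on_def)
    from twin_link_update[where \<xi> = ?\<zeta> and j = j and y = "\<eta> j", OF M MU this]
    have 1: "twin_link (M (\<lambda>_. False, ?\<zeta>)) (M (\<lambda>_. True, ?\<zeta>))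
        (M (\<lambda>_. False, ?\<zeta>(j := \<eta> j))) (M (\<lambda>_. True, ?\<zeta>(j := \<eta> j)))" .
    have "(M (\<lambda>_. False, \<xi>), M (\<lambda>_. False, ?\<zeta>)) \<in> \<theta>"
      by (rule pair_polys_Con[OF M]) (auto simp: override_on_def xy t_refl)
    then show ?case unfolding upd by (rule twin_link_trans[OF insert(3) 1 MU MU MU])
  qed
  from this[of UNIV] show ?thesis by (simp add: override_on_def)
qed

end

section \<open>Two-dimensional matrices and the centrality relations\<close>

definition vertex2 :: "bool \<Rightarrow> bool \<Rightarrow> nat \<Rightarrow> bool" where
  "vertex2 a b i = (if i = 0 then a else b)"

lemma centralizes2I:
  fixes A :: "('s, 'a::finite) ualgebra"
  assumes "\<And>m. m \<in> Mat A [\<alpha>, \<gamma>] \<Longrightarrow>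
    (m (vertex2 False False), m (vertex2 False True)) \<in> \<delta> \<Longrightarrow>
    (m (vertex2 True False), m (vertex2 True True)) \<in> \<delta>"
  shows "centralizes A [\<alpha>, \<gamma>] \<delta>"
  unfolding centralizes_def
proof (intro ballI impI)
  fix m' assume "m' \<in> matrices A [\<alpha>, \<gamma>]"
    and *: "\<forall>e\<in>cube (length [\<alpha>, \<gamma>] - 1) - {replicate (length [\<alpha>, \<gamma>] - 1) True}.
      (m' (e @ [False]), m' (e @ [True])) \<in> \<delta>"
  then obtain m where m: "m \<in> Mat A [\<alpha>, \<gamma>]" and m': "m' = (\<lambda>e\<in>cube (length [\<alpha>, \<gamma>]). m ((!) e))"
    unfolding matrices_eq_Mat by blast
  have eq: "m' [a, b] = m (vertex2 a b)" for a b
  proof -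
    have "m ((!) [a, b]) = m (vertex2 a b)"
      by (rule Mat_cong[OF m]) (auto simp: vertex2_def less_Suc_eq)
    then show ?thesis by (simp add: m' cube_def)
  qed
  have "(m' [False, False], m' [False, True]) \<in> \<delta>"
    using bspec[OF *, of "[False]"] by (simp add: cube_def)
  from assms[OF m this[unfolded eq]]
  show "(m' (replicate (length [\<alpha>, \<gamma>] - 1) True @ [False]),
      m' (replicate (length [\<alpha>, \<gamma>] - 1) True @ [True])) \<in> \<delta>"
    by (simp add: eq)
qed

context nilpotent_minimal_set
begin

text \<open>Assigns to the variable of a pair one of its two ends. Pairs outside \<theta> stay
  constant, so that the two assignments are \<theta>-related at every variable.\<close>

definition corner :: "bool \<Rightarrow> 'a \<times> 'a \<Rightarrow> 'a" where
  "corner b = (\<lambda>(x, y). if (x, y) \<in> \<theta> \<and> b then y else x)"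

lemma corner_\<theta>: "(corner a j, corner b j) \<in> \<theta>"
  unfolding corner_def using t_refl t_sym by (auto split: prod.split)

text \<open>The \<beta>-edges remain parameters, and a \<theta>-edge from \<open>x\<close> to
  \<open>y\<close> becomes the variable indexed by \<open>(x, y)\<close>.\<close>

lemma Mat_pair_polys:
  assumes "m \<in> Mat A [\<beta>, \<theta>]"
  shows "\<exists>M\<in>pair_polys. \<forall>a b. m (vertex2 a b) = M (\<lambda>_. a, corner b)"
proof -
  have "\<exists>M\<in>pair_polys. m = (\<lambda>e. M (e, corner (e 1)))"
    using assms unfolding Mat_def
  proof (rule Clo_factor)
    fix g :: "(nat \<Rightarrow> bool) \<Rightarrow> 'a" assume "g \<in> edge_maps [\<beta>, \<theta>] (\<lambda>e. e)"
    then show "\<exists>M\<in>pair_polys. g = (\<lambda>e. M (e, corner (e 1)))"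
    proof (cases rule: edge_mapsE)
      case (const c)
      then show ?thesis by (intro bexI[of _ "\<lambda>_. c"]) (auto intro: Clo.gen)
    next
      case (edge j x y)
      show ?thesis
      proof (cases "j = 0")
        case True
        have "(\<lambda>i. if fst i j then y else x) \<in> pair_polys"
          using edge(2) True by (intro Clo.gen UnI2 edge_mapsI) auto
        then show ?thesis using edge(3) by (intro bexI[of _ "\<lambda>i. if fst i j then y else x"]) auto
      next
        case False
        then have j: "j = 1" using edge(1) by simp
        have "g = (\<lambda>e. snd (e, corner (e 1)) (x, y))"
          using edge(2) unfolding edge(3) j corner_def by auto
        then show ?thesis
          by (intro bexI[of _ "\<lambda>i. snd i (x, y)"] Clo.gen UnI1) auto
      qed
    qed
  qed
  then obtain M where M: "M \<in> pair_polys" "m = (\<lambda>e. M (e, corner (e 1)))" by blast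
  have "M (vertex2 a b, \<xi>) = M (\<lambda>_. a, \<xi>)" for a b \<xi>
    using M(1) by (rule Clo_cong) (auto elim!: edge_mapsE simp: vertex2_def)
  then show ?thesis using M by (intro bexI[of _ M]) (simp_all add: vertex2_def)
qed

text \<open>Pushing the matrix into \<open>U\<close> makes its rows comparable by a twin link; in
  the applications \<open>p\<close> is chosen so that a failure of centrality survives.\<close>

lemma Mat_separated:
  assumes m: "m \<in> Mat A [\<beta>, \<theta>]" and p: "p \<in> Pol1 A" "range p \<subseteq> U"
  obtains M where "\<forall>i. M i \<in> U" "\<forall>a b. p (m (vertex2 a b)) = M (\<lambda>_ :: nat. a, corner b)"
    "twin_link (M (\<lambda>_. False, corner False)) (M (\<lambda>_. True, corner False))
      (M (\<lambda>_. False, corner True)) (M (\<lambda>_. True, corner True))"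
    "(M (\<lambda>_. False, corner False), M (\<lambda>_. False, corner True)) \<in> \<theta>"
proof -
  obtain M where M: "M \<in> pair_polys" "\<And>a b. m (vertex2 a b) = M (\<lambda>_. a, corner b)"
    using Mat_pair_polys[OF m] by blast
  have pM: "(\<lambda>i. p (M i)) \<in> pair_polys"
    by (rule Pol1_comp_Clo[OF p(1) M(1)]) (auto simp: edge_maps_def)
  have pU: "p x \<in> U" for x using p(2) by blast
  show thesis
    by (rule that[of "\<lambda>i. p (M i)"])
      (use M(2) pU twin_link_assignments[OF pM] pair_polys_Con[OF pM] corner_\<theta> in auto)
qed

text \<open>A failure is moved into \<open>U\<close> by a separating polynomial. There either both
  rows collapse or a member of \<open>T\<close>, which preserves \<delta>, carries the collapsed
  first row to the second modulo \<delta>.\<close>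

lemma centralizes_\<beta>_\<theta>: "centralizes A [\<beta>, \<theta>] \<delta>"
proof (rule centralizes2I, rule ccontr)
  fix m assume m: "m \<in> Mat A [\<beta>, \<theta>]"
    and eq: "(m (vertex2 False False), m (vertex2 False True)) \<in> \<delta>"
    and neg: "(m (vertex2 True False), m (vertex2 True True)) \<notin> \<delta>"
  have "(m (vertex2 True False), m (vertex2 True True)) \<in> \<theta>"
    using m unfolding Mat_def
    by (rule Clo_Con[OF _ con(2)])
      (auto elim!: edge_mapsE simp: vertex2_def less_Suc_eq intro: t_refl)
  then obtain p where p: "p \<in> Pol1 A" "range p \<subseteq> U"
    "(p (m (vertex2 True False)), p (m (vertex2 True True))) \<notin> \<delta>"
    using separation neg by blast
  obtain M where MU: "\<forall>i. M i \<in> U" and M: "\<forall>a b. p (m (vertex2 a b)) = M (\<lambda>_ :: nat. a, corner b)"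
    "twin_link (M (\<lambda>_. False, corner False)) (M (\<lambda>_. True, corner False))
      (M (\<lambda>_. False, corner True)) (M (\<lambda>_. True, corner True))"
    "(M (\<lambda>_. False, corner False), M (\<lambda>_. False, corner True)) \<in> \<theta>"
    by (rule Mat_separated[OF m p(1,2)])
  note MU = MU[rule_format]
  have "(M (\<lambda>_. False, corner False), M (\<lambda>_. False, corner True)) \<in> \<delta>"
    using Pol1_Con[OF p(1) con(1) eq] by (simp add: M(1))
  moreover note T_d[OF _ MU MU]
  ultimately have "(M (\<lambda>_. True, corner False), M (\<lambda>_. True, corner True)) \<in> \<delta>"
    using M(2) d_sym d_trans unfolding twin_link_def by meson
  then show False using p(3) by (simp add: M(1))
qed

text \<open>After transposing, the hypothesis collapses the first column. A group element linking
  the rows then fixes the \<delta>-class of the first entry, hence every class of the block, and the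
  second column collapses too.\<close>

lemma centralizes_\<theta>_\<beta>: "centralizes A [\<theta>, \<beta>] \<delta>"
proof (rule centralizes2I, rule ccontr)
  fix m' assume m': "m' \<in> Mat A [\<theta>, \<beta>]"
    and eq': "(m' (vertex2 False False), m' (vertex2 False True)) \<in> \<delta>"
    and neg': "(m' (vertex2 True False), m' (vertex2 True True)) \<notin> \<delta>"
  define m where "m = (\<lambda>e. m' (vertex2 (e 1) (e (0 :: nat))))"
  have m: "m \<in> Mat A [\<beta>, \<theta>]"
    unfolding Mat_def m_def
  proof (rule Clo_subst[OF m'[unfolded Mat_def]])
    fix g :: "(nat \<Rightarrow> bool) \<Rightarrow> 'a" assume "g \<in> edge_maps [\<theta>, \<beta>] (\<lambda>e. e)"
    then show "(\<lambda>e. g (vertex2 (e 1) (e 0))) \<in> Clo A (edge_maps [\<beta>, \<theta>] (\<lambda>e. e))"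
    proof (cases rule: edge_mapsE)
      case (const c)
      then show ?thesis by (auto intro: Clo.gen)
    next
      case (edge j x y)
      then have "(\<lambda>e. if e (1 - j) then y else x) \<in> edge_maps [\<beta>, \<theta>] (\<lambda>e. e)"
        by (intro edge_mapsI) (auto simp: less_Suc_eq)
      moreover have "(\<lambda>e. g (vertex2 (e 1) (e 0))) = (\<lambda>e. if e (1 - j) then y else x)"
        using edge by (auto simp: vertex2_def less_Suc_eq)
      ultimately show ?thesis by (simp only: Clo.gen)
    qed
  qed
  have swap: "m' (vertex2 a b) = m (vertex2 b a)" for a b
    by (simp add: m_def vertex2_def)
  note eq = eq'[unfolded swap] and neg = neg'[unfolded swap]
  have row: "(m (vertex2 a False), m (vertex2 a True)) \<in> \<theta>" for a
    using m unfolding Mat_def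
    by (rule Clo_Con[OF _ con(2)])
      (auto elim!: edge_mapsE simp: vertex2_def less_Suc_eq intro: t_refl)
  \<comment> \<open>Separation needs a \<theta>-pair: the rows join the second column to the first,
    which lies in \<delta>.\<close>
  have "(m (vertex2 False True), m (vertex2 True True)) \<in> \<theta>"
    using row[of False] row[of True] d_t[OF eq] t_sym t_trans by blast
  then obtain p where p: "p \<in> Pol1 A" "range p \<subseteq> U"
    "(p (m (vertex2 False True)), p (m (vertex2 True True))) \<notin> \<delta>"
    using separation neg by blast
  obtain M where MU: "\<forall>i. M i \<in> U" and M: "\<forall>a b. p (m (vertex2 a b)) = M (\<lambda>_ :: nat. a, corner b)"
    "twin_link (M (\<lambda>_. False, corner False)) (M (\<lambda>_. True, corner False))
      (M (\<lambda>_. False, corner True)) (M (\<lambda>_. True, corner True))"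
    "(M (\<lambda>_. False, corner False), M (\<lambda>_. False, corner True)) \<in> \<theta>"
    by (rule Mat_separated[OF m p(1,2)])
  note MU = MU[rule_format]
  have col: "(M (\<lambda>_. False, corner False), M (\<lambda>_. True, corner False)) \<in> \<delta>"
    using Pol1_Con[OF p(1) con(1) eq] by (simp add: M(1))
  from M(2)[unfolded twin_link_def] have "(M (\<lambda>_. False, corner True), M (\<lambda>_. True, corner True)) \<in> \<delta>"
  proof
    assume "(M (\<lambda>_. False, corner False), M (\<lambda>_. False, corner True)) \<in> \<delta> \<and>
      (M (\<lambda>_. True, corner False), M (\<lambda>_. True, corner True)) \<in> \<delta>"
    then show ?thesis using col d_sym d_trans by blast
  next
    assume "\<exists>g\<in>T. (g (M (\<lambda>_. False, corner False)), M (\<lambda>_. True, corner False)) \<in> \<delta> \<and>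
      (g (M (\<lambda>_. False, corner True)), M (\<lambda>_. True, corner True)) \<in> \<delta>"
    then obtain g where g: "g \<in> T" "(g (M (\<lambda>_. False, corner False)), M (\<lambda>_. True, corner False)) \<in> \<delta>"
      "(g (M (\<lambda>_. False, corner True)), M (\<lambda>_. True, corner True)) \<in> \<delta>" by blast
    have "(g (M (\<lambda>_. False, corner False)), M (\<lambda>_. False, corner False)) \<in> \<delta>"
      using g(2) col d_sym d_trans by blast
    from T_fixed_block[OF g(1) MU this MU M(3)] show ?thesis
      using g(3) d_sym d_trans by blast
  qed
  then show False using p(3) by (simp add: M(1))
qed

end

lemma exists_Min_set:
  fixes A :: "('s, 'a::finite) ualgebra"
  assumes "covers A \<delta> \<theta>"
  shows "\<exists>U. U \<in> Min_sets A \<delta> \<theta>"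
proof -
  define S where "S = {range f | f. f \<in> Pol1 A \<and> \<not> map_prod f f ` \<theta> \<subseteq> \<delta>}"
  have "\<not> map_prod (\<lambda>x. x) (\<lambda>x. x) ` \<theta> \<subseteq> \<delta>"
    using assms unfolding covers_def by (auto simp: map_prod_def)
  then have "range (\<lambda>x. x) \<in> S" unfolding S_def using Pol1_id[of A] by blast
  then have "S \<noteq> {}" by blast
  moreover have "finite S" by simp
  ultimately have "\<exists>U\<in>S. \<forall>V\<in>S. V \<subseteq> U \<longrightarrow> U = V"
    using finite_has_minimal[of S] by simp
  then show ?thesis unfolding Min_sets_def Let_def S_def[symmetric] by auto
qed

theorem theorem2p7:
  fixes A :: "('s, 'a::finite) ualgebra" and \<beta> :: "'a rel" and k :: nat
  assumes "\<beta> \<in> Con A" and "k \<ge> 1"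
  shows "(supernilpotent A k \<beta> \<longrightarrow> snags A \<beta> (k + 1) = {})
    \<and> (snags A \<beta> (k + 1) = {} \<longrightarrow>
         (\<forall>U. minimal_set A U \<longrightarrow> acts_as_nilpotent_group (Tw A \<beta> U) U k))
    \<and> ((\<forall>U. minimal_set A U \<longrightarrow> acts_as_nilpotent_group (Tw A \<beta> U) U k) \<longrightarrow>
         (\<forall>\<delta> \<theta>. covers A \<delta> \<theta> \<longrightarrow> centralizes A [\<beta>, \<theta>] \<delta> \<and> centralizes A [\<theta>, \<beta>] \<delta>))
    \<and> ((\<forall>\<delta> \<theta>. covers A \<delta> \<theta> \<longrightarrow> centralizes A [\<beta>, \<theta>] \<delta> \<and> centralizes A [\<theta>, \<beta>] \<delta>) \<longrightarrow>
         left_nilpotent A \<beta> \<and> right_nilpotent A \<beta>)"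
proof -
  have retract: "\<exists>r. polynomial_retract A \<beta> U r" if "covers A \<delta> \<theta>" "U \<in> Min_sets A \<delta> \<theta>" for U \<delta> \<theta>
    using Min_sets_idempotent[OF that] assms(1) unfolding polynomial_retract_def by blast
  have "acts_as_nilpotent_group (Tw A \<beta> U) U k" if "snags A \<beta> (k + 1) = {}" "minimal_set A U" for U
  proof -
    obtain r where "polynomial_retract A \<beta> U r"
      using \<open>minimal_set A U\<close> retract unfolding minimal_set_def by blast
    then show ?thesis using that(1) by (rule polynomial_retract.no_snags_acts_as_nilpotent_group)
  qed
  moreover have "centralizes A [\<beta>, \<theta>] \<delta> \<and> centralizes A [\<theta>, \<beta>] \<delta>"
    if nil: "\<forall>U. minimal_set A U \<longrightarrow> acts_as_nilpotent_group (Tw A \<beta> U) U k"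
      and cov: "covers A \<delta> \<theta>" for \<delta> \<theta>
  proof -
    \<comment> \<open>One minimal set for the given cover suffices for both centrality
      relations.\<close>
    obtain U where U: "U \<in> Min_sets A \<delta> \<theta>" using exists_Min_set[OF cov] by blast
    obtain r where r: "polynomial_retract A \<beta> U r" using retract[OF cov U] by blast
    have "minimal_set A U" using cov U unfolding minimal_set_def by blast
    then have "nilpotent_minimal_set A \<beta> U r \<delta> \<theta> k"
      using r cov U nil by (simp add: nilpotent_minimal_set_def nilpotent_minimal_set_axioms_def)
    then show ?thesis
      by (intro conjI nilpotent_minimal_set.centralizes_\<beta>_\<theta> nilpotent_minimal_set.centralizes_\<theta>_\<beta>)
  qed
  ultimately show ?thesis
    using supernilpotent_no_snags[OF _ assms(1)] nilpotent_of_central_covers[OF assms(1)] by blast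
qed

end
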